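(* Let $\Lambda$, $\lambda,\mu>0$, $\varphi\in\mathbb R$, $\mathrm B,\Theta,\mathrm T$ and the generator $\mathbf R$ be as in the context. Assume $$\frac{\lambda}{\mu}<1\quad\text{and}\quad \frac{\lambda e^{\varphi}}{\mu}<1 .$$ Then the continuous-time Markov process on $\Lambda\times\mathbb Z_+^\Lambda$ with generator $\mathbf R$ is positive recurrent and reversible. Its stationary probability $\pi(j,\underline n)$ of the state $(j,\underline n)$, $j\in\Lambda$, $\underline n=(n_i)_{i\in\Lambda}\in\mathbb Z_+^\Lambda$, is $$\pi(j,\underline n)=\frac{1}{\#\Lambda}\left(1-\frac{\lambda e^{\varphi}}{\mu}\right)\left(1-\frac{\lambda}{\mu}\right)^{\#\Lambda-1}\left(\frac{\lambda}{\mu}\right)^{\sum_{i\in\Lambda}n_i}e^{\varphi n_j}.$$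
   Context: $\Lambda$ is a finite set of sites, $\#\Lambda$ its cardinality, $\mathbb Z_+=\{0,1,2,\dots\}$. $\lambda>0$, $\mu>0$ and $\varphi\in\mathbb R$ are constants. $\mathrm B=(\beta_{ik})_{i,k\in\Lambda}$, $\Theta=(\theta_{ik})_{i,k\in\Lambda}$, $\mathrm T=(\tau_{ik})_{i,k\in\Lambda}$ are symmetric matrices with nonnegative entries and zero diagonals. They are irreducible in the sense that, for some positive integer $u$, the matrices $\mathrm B^u,\Theta^u,\mathrm T^u$ have strictly positive entries. A state is a pair $(j,\underline n)$, where $j\in\Lambda$ is the site (the "loaded" site) where a single distinguished customer is located, and $\underline n=(n_i)_{i\in\Lambda}\in\mathbb Z_+^\Lambda$ gives the numbers of tasks at the sites. Let $\underline e^i\in\mathbb Z_+^\Lambda$ be the vector with $e^i_l=\delta_{il}$, let $\underline e^{i\to k}=\underline e^k-\underline e^i$, and let $\mathbf 1$ denote the indicator. The generator $\mathbf R$ has the following off-diagonal entries (all other off-diagonal entries are zero): - $R[(j,\underline n);(j,\underline n+\underline e^k)]=\lambda e^{\varphi\delta_{jk}}$, $k\in\Lambda$; - $R[(j,\underline n);(j,\underline n-\underline e^k)]=\mu\,\mathbf 1(n_k\ge1)$, $k\in\Lambda$; - $R[(j,\underline n);(j,\underline n+\underline e^{k\to l})]=\beta_{kl}\mathbf 1(n_k\ge1)$, for $k\ne l$, $k\neq j$, $l\ne j$; - $R[(j,\underline n);(j,\underline n+\underline e^{j\to l})]=\theta_{jl}\mathbf 1(n_j\ge1)$, $l\ne j$;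 - $R[(j,\underline n);(j,\underline n+\underline e^{k\to j})]=\theta_{kj}e^{\varphi}\mathbf 1(n_k\ge1)$, $k\ne j$; - $R[(j,\underline n);(j',\underline n)]=e^{-\varphi n_j}\tau_{jj'}$, $j'\ne j$. *)

theory Defs
  imports "HOL-Probability.Probability"
begin

section \<open>Continuous-time Markov chains on a countable state space\<close>

text \<open>
  A rate matrix is a function Q on pairs of states: nonnegative off-diagonal entries and
  diagonal entries such that the rows sum to zero, so that -Q x x is the total exit rate of x.
\<close>

text \<open>
  Law of the next state of the jump chain: y is chosen with probability Q x y / (-Q x x);
  an absorbing state (exit rate 0) is followed by itself.
\<close>

definition jump_pmf :: "('s \<Rightarrow> 's \<Rightarrow> real) \<Rightarrow> 's \<Rightarrow> 's pmf" where
  "jump_pmf Q x = embed_pmf (\<lambda>y.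
     if Q x x = 0 then of_bool (y = x)
     else if y = x then 0 else Q x y / (- Q x x))"

text \<open>
  Driving randomness for the chain with initial law p, all components independent: the initial
  state (law p), for each step k and each state x a candidate (law jump_pmf Q x) for the
  successor of x, and for each step k a standard exponential variable.
\<close>

type_synonym 's noise = "'s \<times> (nat \<times> 's \<Rightarrow> 's) \<times> (nat \<Rightarrow> real)"

definition chain_space :: "('s \<Rightarrow> 's \<Rightarrow> real) \<Rightarrow> 's pmf \<Rightarrow> 's noise measure" where
  "chain_space Q p =
     measure_pmf p \<Otimes>\<^sub>M
     ((\<Pi>\<^sub>M kx\<in>UNIV. measure_pmf (jump_pmf Q (snd kx))) \<Otimes>\<^sub>M
      (\<Pi>\<^sub>M k\<in>UNIV. density lborel (exponential_density 1)))"

primrec jump_chain :: "nat \<Rightarrow> 's noise \<Rightarrow> 's" where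
  "jump_chain 0 w = fst w"
| "jump_chain (Suc k) w = fst (snd w) (k, jump_chain k w)"

text \<open>
  The holding time at the k-th visited state x is exponential with rate -Q x x. For rate 0 the
  quotient of extended nonnegative reals is infinite whenever the exponential variable is
  positive, i.e. almost surely.
\<close>

definition holding_time :: "('s \<Rightarrow> 's \<Rightarrow> real) \<Rightarrow> nat \<Rightarrow> 's noise \<Rightarrow> ennreal" where
  "holding_time Q k w =
     ennreal (snd (snd w) k) / ennreal (- Q (jump_chain k w) (jump_chain k w))"

definition jump_time :: "('s \<Rightarrow> 's \<Rightarrow> real) \<Rightarrow> nat \<Rightarrow> 's noise \<Rightarrow> ennreal" where
  "jump_time Q m w = (\<Sum>k<m. holding_time Q k w)"

text \<open>
  The (minimal) continuous-time chain with generator Q: at time t it occupies the state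
  jump_chain m, where jump_time m \<le> t < jump_time (m + 1). The value None is taken
  at times not reached after finitely many jumps (after an explosion).
\<close>

definition chain :: "('s \<Rightarrow> 's \<Rightarrow> real) \<Rightarrow> real \<Rightarrow> 's noise \<Rightarrow> 's option" where
  "chain Q t w =
     (if \<exists>m. ennreal t < jump_time Q (Suc m) w
      then Some (jump_chain (LEAST m. ennreal t < jump_time Q (Suc m) w) w)
      else None)"

text \<open>
  Time of the first entrance into x by a jump (for a chain started at x: the first return time);
  it is infinite if there is no such jump.
\<close>

definition return_time :: "('s \<Rightarrow> 's \<Rightarrow> real) \<Rightarrow> 's \<Rightarrow> 's noise \<Rightarrow> ennreal" where
  "return_time Q x w = (INF m\<in>{m. 1 \<le> m \<and> jump_chain m w = x}. jump_time Q m w)"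

text \<open>
  Every state has finite mean return time (so the return time is almost surely finite);
  as usual, an absorbing state counts as positive recurrent.
\<close>

definition positive_recurrent :: "('s \<Rightarrow> 's \<Rightarrow> real) \<Rightarrow> bool" where
  "positive_recurrent Q \<longleftrightarrow>
     (\<forall>x. Q x x = 0 \<or> (\<integral>\<^sup>+ w. return_time Q x w \<partial>chain_space Q (return_pmf x)) < \<infinity>)"

definition stationary :: "('s \<Rightarrow> 's \<Rightarrow> real) \<Rightarrow> 's pmf \<Rightarrow> bool" where
  "stationary Q p \<longleftrightarrow>
     (\<forall>t\<ge>0. \<forall>x.
        measure (chain_space Q p) {w \<in> space (chain_space Q p). chain Q t w = Some x} = pmf p x)"

text \<open>
  Reversibility of the chain started from p: for every horizon T and times ts in [0, T], the
  random vectors (X (ts ! i)) and (X (T - ts ! i)), indexed by i, have the same law.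
\<close>

definition reversible :: "('s \<Rightarrow> 's \<Rightarrow> real) \<Rightarrow> 's pmf \<Rightarrow> bool" where
  "reversible Q p \<longleftrightarrow>
     (\<forall>T ts xs. set ts \<subseteq> {0..T} \<and> length xs = length ts \<longrightarrow>
        measure (chain_space Q p)
          {w \<in> space (chain_space Q p). \<forall>i<length ts. chain Q (ts ! i) w = xs ! i} =
        measure (chain_space Q p)
          {w \<in> space (chain_space Q p). \<forall>i<length ts. chain Q (T - ts ! i) w = xs ! i})"


section \<open>The queueing network with a single distinguished customer\<close>

text \<open>The power operation that real^'a^'a inherits from the type classes is componentwise.\<close>

primrec mat_power :: "real^'a^'a \<Rightarrow> nat \<Rightarrow> real^'a^'a" where
  "mat_power A 0 = mat 1"
| "mat_power A (Suc u) = A ** mat_power A u"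

definition positive_matrix :: "real^'a^'a \<Rightarrow> bool" where
  "positive_matrix A \<longleftrightarrow> (\<forall>i k. 0 < A $ i $ k)"

definition admissible_matrix :: "real^'a^'a \<Rightarrow> bool" where
  "admissible_matrix A \<longleftrightarrow>
     transpose A = A \<and> (\<forall>i k. 0 \<le> A $ i $ k) \<and> (\<forall>i. A $ i $ i = 0)"

type_synonym 'a state = "'a \<times> ('a \<Rightarrow> nat)"

definition add_task :: "'a \<Rightarrow> ('a \<Rightarrow> nat) \<Rightarrow> 'a \<Rightarrow> nat" where
  "add_task k n = n(k := n k + 1)"

text \<open>Only used under the guard 1 \<le> n k, where the subtraction does not truncate.\<close>

definition remove_task :: "'a \<Rightarrow> ('a \<Rightarrow> nat) \<Rightarrow> 'a \<Rightarrow> nat" where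
  "remove_task k n = n(k := n k - 1)"

text \<open>
  Off-diagonal entries. The transitions listed lead to pairwise different states, so for each
  target state at most one summand is nonzero.
\<close>

definition jump_rate ::
  "real \<Rightarrow> real \<Rightarrow> real \<Rightarrow> real^'a^'a \<Rightarrow> real^'a^'a \<Rightarrow> real^'a^'a \<Rightarrow>
   'a::finite state \<Rightarrow> 'a state \<Rightarrow> real" where
  "jump_rate lam mu \<phi> B \<Theta> T = (\<lambda>(j, n) (j', n').
     (if j' = j then
        (\<Sum>k\<in>UNIV. if n' = add_task k n then lam * exp (\<phi> * of_bool (j = k)) else 0) +
        (\<Sum>k\<in>UNIV. if 1 \<le> n k \<and> n' = remove_task k n then mu else 0) +
        (\<Sum>k\<in>UNIV. \<Sum>l\<in>UNIV.
           if k \<noteq> l \<and> k \<noteq> j \<and> l \<noteq> j \<and> 1 \<le> n k \<and> n' = add_task l (remove_task k n)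
           then B $ k $ l else 0) +
        (\<Sum>l\<in>UNIV.
           if l \<noteq> j \<and> 1 \<le> n j \<and> n' = add_task l (remove_task j n)
           then \<Theta> $ j $ l else 0) +
        (\<Sum>k\<in>UNIV.
           if k \<noteq> j \<and> 1 \<le> n k \<and> n' = add_task j (remove_task k n)
           then \<Theta> $ k $ j * exp \<phi> else 0)
      else if n' = n then exp (- \<phi> * real (n j)) * T $ j $ j'
      else 0))"

definition generator ::
  "real \<Rightarrow> real \<Rightarrow> real \<Rightarrow> real^'a^'a \<Rightarrow> real^'a^'a \<Rightarrow> real^'a^'a \<Rightarrow>
   'a::finite state \<Rightarrow> 'a state \<Rightarrow> real" where
  "generator lam mu \<phi> B \<Theta> T x y =
     (if y = x then - (\<Sum>\<^sub>\<infinity>z\<in>-{x}. jump_rate lam mu \<phi> B \<Theta> T x z)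
      else jump_rate lam mu \<phi> B \<Theta> T x y)"

end

theory Submission
  imports Defs
begin

text \<open>
  The weights \<open>(lam / mu) ^ (\<Sum>i. n i) * exp (\<phi> * n j)\<close> satisfy detailed balance with the rates, and the
  mean exit rate under \<open>\<pi>\<close> is finite although the exit rates are unbounded for \<open>\<phi> < 0\<close>. For an
  irreducible chain these two facts suffice. Splitting off the first or the last jump of the chain shows that the
  probability of going from \<open>x\<close> to \<open>y\<close> in time \<open>t\<close> with exactly \<open>m\<close> jumps is symmetric with respect to \<open>\<pi>\<close>;
  hence the expected number of jumps in time \<open>t\<close> is finite and the chain does not explode, so that \<open>\<pi>\<close>
  is stationary and, with the Markov property, reversible. If \<open>\<nu>\<close> is stationary, then so is \<open>min \<nu> \<pi>\<close>,
  and irreducibility gives \<open>\<nu> = \<pi>\<close>. The mean return time is bounded by Kac's argument; a chain that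
  never returned would make the bounded sum of holding times infinite.
\<close>

section \<open>The noise after the first jump\<close>

text \<open>The process is given only through its driving noise, so even the Markov property has to
  be extracted from a product measure. Counting jumps turns this into an induction: for a fixed
  number \<open>m\<close> of jumps every probability satisfies one integral equation at the first
  jump and another at the last jump, with no question of explosion, and detailed balance exchanges
  the two equations. The proof of non-explosion is not circular: symmetry and row sums at most 1
  give only subinvariance of \<pi>, which is enough to bound the expected number of jumps;
  non-explosion then makes all row sums equal to 1 and turns subinvariance into invariance.
  Uniqueness and recurrence are both obtained by bookkeeping of total mass, hence without limit
  theorems for the transition function.\<close>

lemma distr_PiM_split:
  fixes M :: "'i \<Rightarrow> 'a measure" and s :: "'j \<Rightarrow> 'i"
  assumes M: "\<And>i. prob_space (M i)" and s: "inj s" "i0 \<notin> range s"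
  shows "distr (PiM UNIV M) (M i0 \<Otimes>\<^sub>M PiM UNIV (\<lambda>j. M (s j))) (\<lambda>c. (c i0, \<lambda>j. c (s j)))
       = M i0 \<Otimes>\<^sub>M PiM UNIV (\<lambda>j. M (s j))" (is "distr ?U ?P ?f = _")
proof -
  let ?I = "insert i0 (range s)"
  let ?V = "PiM ?I M"
  let ?g = "\<lambda>c :: 'i \<Rightarrow> 'a. (c i0, \<lambda>j. c (s j))"
  have restr: "distr ?U ?V (\<lambda>\<omega>. \<lambda>n\<in>?I. \<omega> n) = ?V"
    using distr_PiM_reindex[of UNIV M "\<lambda>x. x" ?I] M by simp
  have ins: "distr (M i0 \<Otimes>\<^sub>M PiM (range s) M) ?V (\<lambda>(x, X). X(i0 := x)) = ?V"
    by (rule distr_pair_PiM_eq_PiM) (use M in auto)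
  have reidx: "distr (PiM (range s) M) (PiM UNIV (\<lambda>j. M (s j))) (\<lambda>\<omega> j. \<omega> (s j))
      = PiM UNIV (\<lambda>j. M (s j))"
    using distr_PiM_reindex[of "range s" M s UNIV] M s by (simp add: restrict_def)
  have g_meas: "?g \<in> measurable ?V ?P"
    by (intro measurable_Pair measurable_PiM_single' measurable_component_singleton)
       (auto simp: space_PiM PiE_iff)
  have "distr ?U ?P ?f = distr (distr ?U ?V (\<lambda>\<omega>. \<lambda>n\<in>?I. \<omega> n)) ?P ?g"
    by (subst distr_distr) (auto intro!: g_meas measurable_restrict simp: comp_def)
  also have "\<dots> = distr (distr (M i0 \<Otimes>\<^sub>M PiM (range s) M) ?V (\<lambda>(x, X). X(i0 := x))) ?P ?g"
    by (simp add: restr ins)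
  also have "\<dots> = distr (M i0 \<Otimes>\<^sub>M PiM (range s) M) ?P (\<lambda>(x, X). (x, \<lambda>j. X (s j)))"
  proof (subst distr_distr[OF g_meas])
    show "(\<lambda>(x, X). X(i0 := x)) \<in> M i0 \<Otimes>\<^sub>M PiM (range s) M \<rightarrow>\<^sub>M ?V"
      by (subst measurable_cong[where g = "\<lambda>p. (snd p)(i0 := fst p)"])
         (auto intro!: measurable_fun_upd[where J = "range s"])
    have "?g \<circ> (\<lambda>(x, X). X(i0 := x)) = (\<lambda>(x, X). (x, \<lambda>j. X (s j)))"
      using s by (auto simp: fun_eq_iff)
    then show "distr (M i0 \<Otimes>\<^sub>M PiM (range s) M) ?P (?g \<circ> (\<lambda>(x, X). X(i0 := x)))
       = distr (M i0 \<Otimes>\<^sub>M PiM (range s) M) ?P (\<lambda>(x, X). (x, \<lambda>j. X (s j)))" by (simp only:)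
  qed
  also have "\<dots> = distr (M i0) (M i0) (\<lambda>x. x) \<Otimes>\<^sub>M
      distr (PiM (range s) M) (PiM UNIV (\<lambda>j. M (s j))) (\<lambda>\<omega> j. \<omega> (s j))"
  proof (subst pair_measure_distr)
    show "sigma_finite_measure (distr (PiM (range s) M) (PiM UNIV (\<lambda>j. M (s j)))
        (\<lambda>\<omega> j. \<omega> (s j)))"
      unfolding reidx by (intro prob_space_imp_sigma_finite prob_space_PiM M)
  qed (auto intro!: measurable_PiM_single' measurable_component_singleton simp: space_PiM PiE_iff)
  also have "\<dots> = ?P"
    unfolding reidx by (simp add: distr_id2)
  finally show ?thesis .
qed

text \<open>Used for the clocks with \<open>Suc\<close> and index 0, and for the candidates with
  index \<open>(0, x)\<close> and the shift of the step number. In the second case the range of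
  \<open>s\<close> is not the complement of \<open>i0\<close>: the candidates \<open>(0, y)\<close>
  with \<open>y\<close> different from \<open>x\<close> are never consulted and integrate out to
  1.\<close>

lemma nn_integral_PiM_split:
  fixes M :: "'i \<Rightarrow> 'a measure" and s :: "'j \<Rightarrow> 'i"
  assumes M: "\<And>i. prob_space (M i)" and s: "inj s" "i0 \<notin> range s"
    and g: "g \<in> borel_measurable (M i0 \<Otimes>\<^sub>M PiM UNIV (\<lambda>j. M (s j)))"
  shows "(\<integral>\<^sup>+ c. g (c i0, \<lambda>j. c (s j)) \<partial>PiM UNIV M) =
    (\<integral>\<^sup>+ z. \<integral>\<^sup>+ X. g (z, X) \<partial>PiM UNIV (\<lambda>j. M (s j)) \<partial>M i0)"
proof -
  interpret N: prob_space "PiM UNIV (\<lambda>j. M (s j))" by (intro prob_space_PiM M)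
  have "(\<integral>\<^sup>+ c. g (c i0, \<lambda>j. c (s j)) \<partial>PiM UNIV M) =
     (\<integral>\<^sup>+ p. g p \<partial>distr (PiM UNIV M) (M i0 \<Otimes>\<^sub>M PiM UNIV (\<lambda>j. M (s j))) (\<lambda>c. (c i0, \<lambda>j. c (s j))))"
    by (subst nn_integral_distr)
       (auto intro!: g measurable_Pair measurable_PiM_single' measurable_component_singleton simp: space_PiM PiE_iff)
  also have "\<dots> = (\<integral>\<^sup>+ z. \<integral>\<^sup>+ X. g (z, X) \<partial>PiM UNIV (\<lambda>j. M (s j)) \<partial>M i0)"
    unfolding distr_PiM_split[of M s i0, OF M s] by (rule N.nn_integral_fst[OF g, symmetric])
  finally show ?thesis .
qed

section \<open>The noise measure as an iterated integral\<close>

abbreviation std_exponential :: "real measure" where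
  "std_exponential \<equiv> density lborel (exponential_density 1)"

definition cands :: "('s \<Rightarrow> 's \<Rightarrow> real) \<Rightarrow> (nat \<times> 's \<Rightarrow> 's) measure" where
  "cands Q = (\<Pi>\<^sub>M kx\<in>UNIV. measure_pmf (jump_pmf Q (snd kx)))"

definition clocks :: "(nat \<Rightarrow> real) measure" where
  "clocks = (\<Pi>\<^sub>M k\<in>UNIV. std_exponential)"

text \<open>Only its sets matter. They depend neither on the rates nor on the initial law, so one
  measurability proof serves all the measures \<open>chain_space Q p\<close> at once.\<close>

definition noise_algebra :: "'s noise measure" where
  "noise_algebra = count_space UNIV \<Otimes>\<^sub>M
     ((\<Pi>\<^sub>M kx\<in>UNIV. count_space UNIV) \<Otimes>\<^sub>M (\<Pi>\<^sub>M k\<in>UNIV. borel))"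

lemma prob_space_std_exponential: "prob_space std_exponential"
  by (rule prob_space_exponential_density) simp

lemma prob_space_cands: "prob_space (cands Q)"
  unfolding cands_def by (intro prob_space_PiM measure_pmf.prob_space_axioms)

lemma prob_space_clocks: "prob_space clocks"
  unfolding clocks_def by (intro prob_space_PiM prob_space_std_exponential)

lemma chain_space_eq: "chain_space Q p = measure_pmf p \<Otimes>\<^sub>M (cands Q \<Otimes>\<^sub>M clocks)"
  by (simp add: chain_space_def cands_def clocks_def)

lemma prob_space_chain_space: "prob_space (chain_space Q p)"
proof -
  interpret c: prob_space "cands Q" by (rule prob_space_cands)
  interpret e: prob_space clocks by (rule prob_space_clocks)
  interpret ce: pair_prob_space "cands Q" clocks ..
  interpret pce: pair_prob_space "measure_pmf p" "cands Q \<Otimes>\<^sub>M clocks" ..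
  show ?thesis unfolding chain_space_eq by (rule pce.prob_space_axioms)
qed

lemma sets_cands: "sets (cands Q) = sets (\<Pi>\<^sub>M kx\<in>UNIV. count_space UNIV)"
  unfolding cands_def by (rule sets_PiM_cong) auto

lemma sets_clocks: "sets clocks = sets (\<Pi>\<^sub>M k\<in>UNIV. borel)"
  unfolding clocks_def by (rule sets_PiM_cong) auto

lemma sets_chain_space [simp, measurable_cong]: "sets (chain_space Q p) = sets noise_algebra"
  unfolding chain_space_eq noise_algebra_def
  by (intro sets_pair_measure_cong sets_cands sets_clocks) simp

lemma space_noise_algebra [simp]: "space noise_algebra = UNIV"
  by (simp add: noise_algebra_def space_pair_measure space_PiM PiE_UNIV_domain)

lemma space_chain_space [simp]: "space (chain_space Q p) = UNIV"
  using sets_eq_imp_space_eq[OF sets_chain_space] by simp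

lemma nn_integral_chain_space:
  assumes f: "f \<in> borel_measurable noise_algebra"
  shows "(\<integral>\<^sup>+ w. f w \<partial>chain_space Q p) =
    (\<integral>\<^sup>+ x. \<integral>\<^sup>+ c. \<integral>\<^sup>+ e. f (x, c, e) \<partial>clocks \<partial>cands Q \<partial>measure_pmf p)"
proof -
  interpret c: prob_space "cands Q" by (rule prob_space_cands)
  interpret e: prob_space clocks by (rule prob_space_clocks)
  interpret ce: pair_prob_space "cands Q" clocks ..
  have f': "f \<in> borel_measurable (measure_pmf p \<Otimes>\<^sub>M (cands Q \<Otimes>\<^sub>M clocks))"
    unfolding chain_space_eq[symmetric] measurable_cong_sets[OF sets_chain_space refl] by (rule f)
  have "(\<integral>\<^sup>+ w. f w \<partial>chain_space Q p) =
      (\<integral>\<^sup>+ x. \<integral>\<^sup>+ ce. f (x, ce) \<partial>(cands Q \<Otimes>\<^sub>M clocks) \<partial>measure_pmf p)"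
    unfolding chain_space_eq by (rule ce.nn_integral_fst[OF f', symmetric])
  also have "\<dots> = (\<integral>\<^sup>+ x. \<integral>\<^sup>+ c. \<integral>\<^sup>+ e. f (x, c, e) \<partial>clocks \<partial>cands Q \<partial>measure_pmf p)"
    by (intro nn_integral_cong e.nn_integral_fst[symmetric] measurable_compose[OF _ f'])
       (auto intro!: measurable_Pair)
  finally show ?thesis .
qed

definition start_at :: "('s \<Rightarrow> 's \<Rightarrow> real) \<Rightarrow> 's \<Rightarrow> 's noise measure" where
  "start_at Q x = chain_space Q (return_pmf x)"

lemma sets_start_at [simp, measurable_cong]: "sets (start_at Q x) = sets noise_algebra"
  by (simp add: start_at_def)

lemma space_start_at [simp]: "space (start_at Q x) = UNIV"
  by (simp add: start_at_def)

lemma prob_space_start_at: "prob_space (start_at Q x)"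
  by (simp add: start_at_def prob_space_chain_space)

lemma nn_integral_start_at:
  assumes f: "f \<in> borel_measurable noise_algebra"
  shows "(\<integral>\<^sup>+ w. f w \<partial>start_at Q x) = (\<integral>\<^sup>+ c. \<integral>\<^sup>+ e. f (x, c, e) \<partial>clocks \<partial>cands Q)"
  unfolding start_at_def nn_integral_chain_space[OF f] by simp

lemma nn_integral_chain_space_start_at:
  assumes f: "f \<in> borel_measurable noise_algebra"
  shows "(\<integral>\<^sup>+ w. f w \<partial>chain_space Q p) = (\<integral>\<^sup>+ x. \<integral>\<^sup>+ w. f w \<partial>start_at Q x \<partial>measure_pmf p)"
  unfolding nn_integral_chain_space[OF f] nn_integral_start_at[OF f] ..

lemma measurable_fst_noise [measurable]: "fst \<in> noise_algebra \<rightarrow>\<^sub>M count_space UNIV"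
  by (simp add: noise_algebra_def)

lemma AE_start_at_fst: "AE w in start_at Q x. fst w = x"
proof -
  have m [measurable]: "(\<lambda>w :: 'a noise. if fst w = x then 0 else 1 :: ennreal) \<in> borel_measurable noise_algebra"
    by (rule measurable_compose[OF measurable_fst_noise]) simp
  have "(\<integral>\<^sup>+ w. (if fst w = x then 0 else 1) \<partial>start_at Q x) = (0 :: ennreal)"
    by (subst nn_integral_start_at[OF m]) simp
  then have "AE w in start_at Q x. (if fst w = x then 0 else 1) = (0 :: ennreal)"
    by (subst (asm) nn_integral_0_iff_AE) auto
  then show ?thesis by eventually_elim (auto split: if_splits)
qed

text \<open>The shift past the first jump: the state just entered becomes the initial state, and
  candidates and clocks are renumbered, so that the shifted noise drives the remaining
  process.\<close>

definition advance :: "'s noise \<Rightarrow> 's noise" where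
  "advance w = (fst (snd w) (0, fst w), \<lambda>kx. fst (snd w) (Suc (fst kx), snd kx), \<lambda>k. snd (snd w) (Suc k))"

text \<open>Renewal at the first jump: the first clock is independent of the rest, and given the
  next state \<open>z\<close> the shifted noise has the law \<open>start_at Q z\<close>. All later
  recursions come from this identity.\<close>

lemma nn_integral_first_step:
  fixes f :: "real \<times> 's noise \<Rightarrow> ennreal"
  assumes f [measurable]: "f \<in> borel_measurable (borel \<Otimes>\<^sub>M noise_algebra)"
    and m: "(\<lambda>w. f (snd (snd w) 0, advance w)) \<in> borel_measurable noise_algebra"
  shows "(\<integral>\<^sup>+ w. f (snd (snd w) 0, advance w) \<partial>start_at Q x) =
    (\<integral>\<^sup>+ t. \<integral>\<^sup>+ z. \<integral>\<^sup>+ w. f (t, w) \<partial>start_at Q z \<partial>measure_pmf (jump_pmf Q x) \<partial>std_exponential)"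
proof -
  interpret c: prob_space "cands Q" by (rule prob_space_cands)
  interpret e: prob_space clocks by (rule prob_space_clocks)
  interpret ce: pair_prob_space "cands Q" clocks ..
  interpret E: prob_space std_exponential by (rule prob_space_std_exponential)
  have f' [measurable]: "f \<in> borel_measurable (borel \<Otimes>\<^sub>M (count_space UNIV \<Otimes>\<^sub>M (cands Q \<Otimes>\<^sub>M clocks)))"
  proof -
    have "sets (borel \<Otimes>\<^sub>M (count_space UNIV \<Otimes>\<^sub>M (cands Q \<Otimes>\<^sub>M clocks))) =
       sets ((borel :: real measure) \<Otimes>\<^sub>M (noise_algebra :: 's noise measure))"
      unfolding noise_algebra_def by (intro sets_pair_measure_cong sets_cands sets_clocks refl)
    then show ?thesis using f by (simp cong: measurable_cong_sets)
  qed
  have [measurable_cong]: "sets clocks = sets (\<Pi>\<^sub>M k\<in>UNIV. std_exponential)" by (simp add: clocks_def)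
  \<comment> \<open>With the initial state fixed to \<open>x\<close>, the candidate read at the
    first jump has the deterministic index \<open>(0, x)\<close>, so the product measure can be
    split there.\<close>
  have "(\<integral>\<^sup>+ w. f (snd (snd w) 0, advance w) \<partial>start_at Q x) =
    (\<integral>\<^sup>+ c. \<integral>\<^sup>+ e. f (e 0, c (0, x), \<lambda>kx. c (Suc (fst kx), snd kx), \<lambda>k. e (Suc k)) \<partial>clocks \<partial>cands Q)"
    by (subst nn_integral_start_at[OF m]) (simp add: advance_def)
  also have "\<dots> = (\<integral>\<^sup>+ c. \<integral>\<^sup>+ t. \<integral>\<^sup>+ e. f (t, c (0, x), \<lambda>kx. c (Suc (fst kx), snd kx), e)
       \<partial>clocks \<partial>std_exponential \<partial>cands Q)"
  proof (intro nn_integral_cong)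
    fix c :: "nat \<times> 's \<Rightarrow> 's"
    have "(\<lambda>p. f (fst p, c (0, x), \<lambda>kx. c (Suc (fst kx), snd kx), snd p))
      \<in> borel_measurable (std_exponential \<Otimes>\<^sub>M clocks)"
      by (rule measurable_compose[OF _ f'])
        (auto intro!: measurable_Pair simp: cands_def space_PiM PiE_UNIV_domain cong: measurable_cong_sets)
    from nn_integral_PiM_split[of "\<lambda>_. std_exponential" Suc 0, OF _ _ _ this[unfolded clocks_def]]
    show "(\<integral>\<^sup>+ e. f (e 0, c (0, x), \<lambda>kx. c (Suc (fst kx), snd kx), \<lambda>k. e (Suc k)) \<partial>clocks)
      = (\<integral>\<^sup>+ t. \<integral>\<^sup>+ e. f (t, c (0, x), \<lambda>kx. c (Suc (fst kx), snd kx), e)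
       \<partial>clocks \<partial>std_exponential)"
      by (auto simp: clocks_def prob_space_std_exponential)
  qed
  also have "\<dots> = (\<integral>\<^sup>+ z. \<integral>\<^sup>+ c. \<integral>\<^sup>+ t. \<integral>\<^sup>+ e. f (t, z, c, e)
       \<partial>clocks \<partial>std_exponential \<partial>cands Q \<partial>measure_pmf (jump_pmf Q x))"
  proof -
    have "(\<lambda>p. \<integral>\<^sup>+ t. \<integral>\<^sup>+ e. f (t, fst p, snd p, e) \<partial>clocks \<partial>std_exponential)
      \<in> borel_measurable (measure_pmf (jump_pmf Q x) \<Otimes>\<^sub>M cands Q)"
      by measurable
    moreover have "inj (\<lambda>kx :: nat \<times> 's. (Suc (fst kx), snd kx))"
      by (auto simp: inj_on_def)
    ultimately show ?thesis
      using nn_integral_PiM_split[of "\<lambda>kx. measure_pmf (jump_pmf Q (snd kx))"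
         "\<lambda>kx. (Suc (fst kx), snd kx)" "(0, x)" 
         "\<lambda>p. \<integral>\<^sup>+ t. \<integral>\<^sup>+ e. f (t, fst p, snd p, e) \<partial>clocks \<partial>std_exponential"]
      by (auto simp: cands_def measure_pmf.prob_space_axioms)
  qed
  \<comment> \<open>The first clock is moved outwards so that the candidate and clock integrals
    become adjacent and reassemble into \<open>start_at Q z\<close>.\<close>
  also have "\<dots> = (\<integral>\<^sup>+ z. \<integral>\<^sup>+ t. \<integral>\<^sup>+ c. \<integral>\<^sup>+ e. f (t, z, c, e)
       \<partial>clocks \<partial>cands Q \<partial>std_exponential \<partial>measure_pmf (jump_pmf Q x))"
  proof (intro nn_integral_cong)
    fix z
    interpret P: pair_sigma_finite std_exponential "cands Q"
      by (intro pair_sigma_finite.intro E.sigma_finite_measure_axioms c.sigma_finite_measure_axioms)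
    show "(\<integral>\<^sup>+ c. \<integral>\<^sup>+ t. \<integral>\<^sup>+ e. f (t, z, c, e) \<partial>clocks \<partial>std_exponential \<partial>cands Q) =
       (\<integral>\<^sup>+ t. \<integral>\<^sup>+ c. \<integral>\<^sup>+ e. f (t, z, c, e) \<partial>clocks \<partial>cands Q \<partial>std_exponential)"
      by (rule P.Fubini') measurable
  qed
  also have "\<dots> = (\<integral>\<^sup>+ z. \<integral>\<^sup>+ t. \<integral>\<^sup>+ w. f (t, w) \<partial>start_at Q z \<partial>std_exponential \<partial>measure_pmf (jump_pmf Q x))"
    by (intro nn_integral_cong, subst nn_integral_start_at) (auto intro!: measurable_compose[OF _ f])
  also have "\<dots> = (\<integral>\<^sup>+ t. \<integral>\<^sup>+ z. \<integral>\<^sup>+ w. f (t, w) \<partial>start_at Q z \<partial>measure_pmf (jump_pmf Q x) \<partial>std_exponential)"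
  proof -
    interpret P: pair_sigma_finite std_exponential "measure_pmf (jump_pmf Q x)"
      by (intro pair_sigma_finite.intro E.sigma_finite_measure_axioms
         prob_space_imp_sigma_finite measure_pmf.prob_space_axioms)
    have eq: "(\<integral>\<^sup>+ w. f (t, w) \<partial>start_at Q z) = (\<integral>\<^sup>+ c. \<integral>\<^sup>+ e. f (t, z, c, e) \<partial>clocks \<partial>cands Q)" for t z
      by (subst nn_integral_start_at) (auto intro!: measurable_compose[OF _ f])
    show ?thesis unfolding eq by (rule P.Fubini') measurable
  qed
  finally show ?thesis .
qed

section \<open>Recursion at the first jump\<close>

text \<open>The event that exactly \<open>m\<close> jumps have occurred by time \<open>t\<close>.
  Unlike the \<open>LEAST\<close> in \<open>chain\<close>, it passes through \<open>advance\<close>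
  with \<open>m\<close> lowered by one.\<close>

definition sojourn :: "('s \<Rightarrow> 's \<Rightarrow> real) \<Rightarrow> nat \<Rightarrow> real \<Rightarrow> 's noise \<Rightarrow> bool" where
  "sojourn Q m t w \<longleftrightarrow> jump_time Q m w \<le> ennreal t \<and> ennreal t < jump_time Q (Suc m) w"

lemma jump_time_0 [simp]: "jump_time Q 0 w = 0"
  by (simp add: jump_time_def)

lemma jump_time_mono: "m \<le> n \<Longrightarrow> jump_time Q m w \<le> jump_time Q n w"
  unfolding jump_time_def by (intro sum_mono2) auto

lemma sojourn_unique:
  assumes "sojourn Q m t w" "sojourn Q n t w" shows "m = n"
proof -
  have "\<not> k < l" if "sojourn Q k t w" "sojourn Q l t w" for k l
  proof
    assume "k < l"
    then have "jump_time Q (Suc k) w \<le> jump_time Q l w" by (intro jump_time_mono) simp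
    also have "\<dots> \<le> ennreal t" using that by (simp add: sojourn_def)
    also have "\<dots> < jump_time Q (Suc k) w" using that by (simp add: sojourn_def)
    finally show False by simp
  qed
  from this[OF assms] this[OF assms(2,1)] show ?thesis by simp
qed

lemma chain_eq_Some_iff: "chain Q t w = Some y \<longleftrightarrow> (\<exists>m. sojourn Q m t w \<and> jump_chain m w = y)"
proof (cases "\<exists>m. ennreal t < jump_time Q (Suc m) w")
  case True
  define m where "m = (LEAST m. ennreal t < jump_time Q (Suc m) w)"
  have m: "ennreal t < jump_time Q (Suc m) w"
    unfolding m_def using True by (rule LeastI_ex)
  have "jump_time Q m w \<le> ennreal t"
  proof (cases m)
    case (Suc k)
    then have "\<not> ennreal t < jump_time Q (Suc k) w"
      unfolding m_def by (metis lessI not_less_Least)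
    then show ?thesis by (simp add: Suc)
  qed simp
  then have "sojourn Q m t w" using m by (simp add: sojourn_def)
  moreover have "chain Q t w = Some (jump_chain m w)"
    using True by (simp add: chain_def m_def)
  ultimately show ?thesis by (auto dest: sojourn_unique[OF _ \<open>sojourn Q m t w\<close>])
next
  case False
  then show ?thesis by (auto simp: chain_def sojourn_def)
qed

lemma chain_eq_None_iff: "chain Q t w = None \<longleftrightarrow> (\<forall>m. jump_time Q (Suc m) w \<le> ennreal t)"
  by (auto simp: chain_def simp flip: not_le)

lemma jump_chain_Suc_advance: "jump_chain (Suc k) w = jump_chain k (advance w)"
  by (induction k) (simp_all add: advance_def)

lemma holding_time_Suc_advance: "holding_time Q (Suc k) w = holding_time Q k (advance w)"
  by (simp only: holding_time_def jump_chain_Suc_advance) (simp add: advance_def)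

lemma jump_time_Suc_advance: "jump_time Q (Suc m) w = holding_time Q 0 w + jump_time Q m (advance w)"
  by (simp add: jump_time_def sum.lessThan_Suc_shift holding_time_Suc_advance del: sum.lessThan_Suc)

lemma ennreal_add_le_ennreal_iff:
  assumes "0 \<le> h" "h \<le> t"
  shows "ennreal h + a \<le> ennreal t \<longleftrightarrow> a \<le> ennreal (t - h)"
proof (cases a)
  case (real r)
  then show ?thesis using assms
    by (simp add: ennreal_plus[symmetric] ennreal_le_iff le_diff_eq add.commute del: ennreal_plus)
qed (simp add: top_unique)

section \<open>Measurability of the chain over a countable state space\<close>

lemma measurable_candidate [measurable]: "(\<lambda>w. fst (snd w) i) \<in> noise_algebra \<rightarrow>\<^sub>M count_space UNIV"
  unfolding noise_algebra_def by measurable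

lemma measurable_clock [measurable]: "(\<lambda>w. snd (snd w) i) \<in> noise_algebra \<rightarrow>\<^sub>M borel"
  unfolding noise_algebra_def by measurable

lemma measurable_jump_chain [measurable]:
  "jump_chain k \<in> noise_algebra \<rightarrow>\<^sub>M count_space (UNIV :: 's::countable set)"
proof (induction k)
  case 0
  then show ?case by (simp add: measurable_fst_noise)
next
  case (Suc k)
  have "(\<lambda>w :: 's noise. fst (snd w) (k, jump_chain k w)) \<in> noise_algebra \<rightarrow>\<^sub>M count_space UNIV"
    by (rule measurable_compose_countable[where g = "jump_chain k" and f = "\<lambda>y w. fst (snd w) (k, y)"])
       (use Suc in measurable)
  then show ?case by simp
qed

lemma measurable_holding_time [measurable]:
  fixes Q :: "'s::countable \<Rightarrow> 's \<Rightarrow> real"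
  shows "holding_time Q k \<in> borel_measurable noise_algebra"
proof -
  have "(\<lambda>w. - Q (jump_chain k w) (jump_chain k w)) \<in> borel_measurable noise_algebra"
    by (rule measurable_compose[OF measurable_jump_chain[of k], of "\<lambda>y. - Q y y"]) simp
  then show ?thesis unfolding holding_time_def[abs_def] by measurable
qed

lemma measurable_jump_time [measurable]:
  fixes Q :: "'s::countable \<Rightarrow> 's \<Rightarrow> real"
  shows "jump_time Q k \<in> borel_measurable noise_algebra"
  unfolding jump_time_def[abs_def] by measurable

lemma measurable_advance [measurable]:
  "advance \<in> noise_algebra \<rightarrow>\<^sub>M (noise_algebra :: 's::countable noise measure)"
proof -
  have "(\<lambda>w :: 's noise. fst (snd w) (0, fst w)) \<in> noise_algebra \<rightarrow>\<^sub>M count_space UNIV"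
    using measurable_jump_chain[of "Suc 0"] by simp
  then show ?thesis
    unfolding advance_def[abs_def] noise_algebra_def[where ?'s = 's]
    apply (intro measurable_Pair measurable_PiM_single')
    unfolding noise_algebra_def[symmetric] by (auto simp: space_PiM PiE_iff)
qed

lemma pred_sojourn [measurable]:
  fixes Q :: "'s::countable \<Rightarrow> 's \<Rightarrow> real"
  assumes [measurable]: "f \<in> borel_measurable M" "g \<in> M \<rightarrow>\<^sub>M noise_algebra"
  shows "Measurable.pred M (\<lambda>x. sojourn Q m (f x) (g x))"
  unfolding sojourn_def by measurable

lemma pred_jump_chain [measurable]:
  fixes y :: "'s::countable"
  assumes [measurable]: "g \<in> M \<rightarrow>\<^sub>M noise_algebra"
  shows "Measurable.pred M (\<lambda>x. jump_chain m (g x) = y)"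
  by measurable

lemma pred_chain [measurable]:
  fixes Q :: "'s::countable \<Rightarrow> 's \<Rightarrow> real"
  assumes [measurable]: "f \<in> borel_measurable M" "g \<in> M \<rightarrow>\<^sub>M noise_algebra"
  shows "Measurable.pred M (\<lambda>x. chain Q (f x) (g x) = y)"
proof (cases y)
  case None
  then show ?thesis unfolding None chain_eq_None_iff by measurable
next
  case (Some z)
  then show ?thesis unfolding Some chain_eq_Some_iff by measurable
qed

text \<open>A standard exponential variable divided by \<open>a\<close> is exponential of rate
  \<open>a\<close>. The factor \<open>a\<close> of the density is kept apart, because it later
  merges with the jump law into the rates.\<close>

lemma nn_integral_std_exponential_scale:
  assumes [measurable]: "f \<in> borel_measurable borel" and a: "0 < a"
  shows "(\<integral>\<^sup>+ t. f (t / a) \<partial>std_exponential) =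
    (\<integral>\<^sup>+ h. indicator {0..} h * (ennreal (exp (- a * h)) * (ennreal a * f h)) \<partial>lborel)"
proof -
  have "(\<integral>\<^sup>+ t. f (t / a) \<partial>std_exponential) = (\<integral>\<^sup>+ t. exponential_density 1 t * f (t / a) \<partial>lborel)"
    by (subst nn_integral_density) auto
  also have "\<dots> = ennreal a * (\<integral>\<^sup>+ h. exponential_density 1 (a * h) * f h \<partial>lborel)"
    using a by (subst nn_integral_real_affine[where c = a and t = 0]) auto
  also have "\<dots> = (\<integral>\<^sup>+ h. ennreal a * (exponential_density 1 (a * h) * f h) \<partial>lborel)"
    by (subst nn_integral_cmult) auto
  also have "\<dots> = (\<integral>\<^sup>+ h. indicator {0..} h * (ennreal (exp (- a * h)) * (ennreal a * f h)) \<partial>lborel)"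
    using a by (intro nn_integral_cong)
      (auto simp: exponential_density_def mult_less_0_iff mult_ac split: split_indicator)
  finally show ?thesis .
qed

lemma borel_measurable_nn_integral_count_space [measurable (raw)]:
  fixes f :: "'i::countable \<Rightarrow> 'a \<Rightarrow> ennreal"
  assumes [measurable]: "\<And>i. f i \<in> borel_measurable M"
  shows "(\<lambda>x. \<integral>\<^sup>+ i. f i x \<partial>count_space UNIV) \<in> borel_measurable M"
proof -
  interpret sigma_finite_measure "count_space (UNIV :: 'i set)"
    by (rule sigma_finite_measure_count_space)
  have "(\<lambda>p. f (snd p) (fst p)) \<in> borel_measurable (M \<Otimes>\<^sub>M count_space UNIV)"
    by (rule measurable_compose_countable[where g = snd and f = "\<lambda>i p. f i (fst p)"]) measurable
  then show ?thesis by (intro borel_measurable_nn_integral) (simp add: split_beta')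
qed

section \<open>Chains with positive exit rates and the integral equation at the first jump\<close>

locale ctmc =
  fixes Q :: "'s::countable \<Rightarrow> 's \<Rightarrow> real"
  assumes rate_nonneg: "x \<noteq> y \<Longrightarrow> 0 \<le> Q x y"
    and exit_rate_pos: "Q x x < 0"
    and conservative: "(\<integral>\<^sup>+ y. (if y = x then 0 else ennreal (Q x y)) \<partial>count_space UNIV) = ennreal (- Q x x)"
begin

abbreviation q :: "'s \<Rightarrow> real" where "q x \<equiv> - Q x x"

text \<open>The zero diagonal lets sums over jumps run over all states, and the values in
  \<open>ennreal\<close> make interchanges of sums and integrals free of summability
  conditions.\<close>

definition K :: "'s \<Rightarrow> 's \<Rightarrow> ennreal" where
  "K x y = (if y = x then 0 else ennreal (Q x y))"

lemma q_pos: "0 < q x" using exit_rate_pos[of x] by simp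

lemma nn_integral_K: "(\<integral>\<^sup>+ y. K x y \<partial>count_space UNIV) = ennreal (q x)"
  unfolding K_def by (rule conservative)

text \<open>\<open>embed_pmf\<close> returns the intended mass function only if the masses sum to 1,
  which is where \<open>conservative\<close> enters. Multiplying by the exit rate avoids division in
  \<open>ennreal\<close>.\<close>

lemma pmf_jump: "ennreal (q x) * ennreal (pmf (jump_pmf Q x) y) = K x y"
proof -
  let ?f = "\<lambda>y. if Q x x = 0 then of_bool (y = x) else if y = x then 0 else Q x y / q x"
  have f: "ennreal (?f y) = ennreal (1 / q x) * K x y" for y
    using q_pos[of x] by (auto simp: K_def ennreal_mult'[symmetric])
  have nn: "0 \<le> ?f y" for y using q_pos[of x] rate_nonneg[of x y] by (auto simp: divide_nonneg_neg)
  have "(\<integral>\<^sup>+ y. ennreal (?f y) \<partial>count_space UNIV) = 1"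
    unfolding f using q_pos[of x]
    by (subst nn_integral_cmult) (auto simp: nn_integral_K ennreal_mult'[symmetric] simp flip: ennreal_1)
  then have "pmf (jump_pmf Q x) y = ?f y"
    unfolding jump_pmf_def by (intro pmf_embed_pmf nn) auto
  then show ?thesis
    using q_pos[of x] f[of y] unfolding K_def by (auto simp: ennreal_mult'[symmetric])
qed

lemma nn_integral_jump: 
  "ennreal (q x) * (\<integral>\<^sup>+ z. g z \<partial>measure_pmf (jump_pmf Q x)) = (\<integral>\<^sup>+ z. K x z * g z \<partial>count_space UNIV)"
  by (simp add: nn_integral_measure_pmf nn_integral_cmult[symmetric] mult.assoc[symmetric] pmf_jump)

lemma holding_time_0: "holding_time Q 0 w = ennreal (snd (snd w) 0 / q (fst w))"
proof -
  have "ennreal a / ennreal b = ennreal (a / b)" if "0 < b" for a b :: real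
    using that by (cases "0 \<le> a") (auto simp: divide_ennreal ennreal_neg divide_nonpos_pos)
  then show ?thesis unfolding holding_time_def using q_pos by simp
qed

text \<open>The density \<open>q x * exp (- q x * h)\<close> of the first holding time times the
  jump law is \<open>exp (- q x * h) * K x z\<close>. The relation between \<open>G\<close> and
  \<open>F\<close> is required only for noise starting at \<open>x\<close>, which is almost all of
  it.\<close>

lemma nn_integral_first_jump:
  assumes F [measurable]: "F \<in> borel_measurable (borel \<Otimes>\<^sub>M noise_algebra)"
    and G [measurable]: "G \<in> borel_measurable noise_algebra"
    and eq: "\<And>w. fst w = x \<Longrightarrow> G w = F (snd (snd w) 0 / q x, advance w)"
  shows "(\<integral>\<^sup>+ w. G w \<partial>start_at Q x) = (\<integral>\<^sup>+ h. indicator {0..} h * (ennreal (exp (- q x * h)) *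
    (\<integral>\<^sup>+ z. K x z * (\<integral>\<^sup>+ w. F (h, w) \<partial>start_at Q z) \<partial>count_space UNIV)) \<partial>lborel)"
proof -
  interpret S: prob_space "start_at Q z" for z by (rule prob_space_start_at)
  define F' where "F' = (\<lambda>p. F (fst p / q x, snd p))"
  have F' [measurable]: "F' \<in> borel_measurable (borel \<Otimes>\<^sub>M noise_algebra)"
    unfolding F'_def by measurable
  define I where "I h = (\<integral>\<^sup>+ z. \<integral>\<^sup>+ w. F (h, w) \<partial>start_at Q z \<partial>measure_pmf (jump_pmf Q x))" for h
  have I1 [measurable]: "(\<lambda>h. \<integral>\<^sup>+ w. F (h, w) \<partial>start_at Q z) \<in> borel_measurable borel" for z
    by measurable
  have I2 [measurable]: "I \<in> borel_measurable borel"
    unfolding I_def nn_integral_measure_pmf by (intro borel_measurable_nn_integral_count_space) measurable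
  have "(\<integral>\<^sup>+ w. G w \<partial>start_at Q x) = (\<integral>\<^sup>+ w. F' (snd (snd w) 0, advance w) \<partial>start_at Q x)"
    using AE_start_at_fst[where Q = Q and x = x]
    by (intro nn_integral_cong_AE) (auto elim!: eventually_mono simp: eq F'_def)
  also have "\<dots> = (\<integral>\<^sup>+ t. I (t / q x) \<partial>std_exponential)"
    by (subst nn_integral_first_step[OF F']) (simp_all add: I_def F'_def)
  also have "\<dots> = (\<integral>\<^sup>+ h. indicator {0..} h * (ennreal (exp (- q x * h)) *
    (\<integral>\<^sup>+ z. K x z * (\<integral>\<^sup>+ w. F (h, w) \<partial>start_at Q z) \<partial>count_space UNIV)) \<partial>lborel)"
    by (subst nn_integral_std_exponential_scale[OF I2 q_pos]) (simp add: I_def nn_integral_jump)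
  finally show ?thesis .
qed

lemma emeasure_first_jump:
  assumes F [measurable]: "Measurable.pred (borel \<Otimes>\<^sub>M noise_algebra) (\<lambda>p. F (fst p) (snd p))"
    and G [measurable]: "Measurable.pred noise_algebra G"
    and eq: "\<And>w. fst w = x \<Longrightarrow> G w \<longleftrightarrow> F (snd (snd w) 0 / q x) (advance w)"
  shows "emeasure (start_at Q x) {w. G w} = (\<integral>\<^sup>+ h. indicator {0..} h * (ennreal (exp (- q x * h)) *
    (\<integral>\<^sup>+ z. K x z * emeasure (start_at Q z) {w. F h w} \<partial>count_space UNIV)) \<partial>lborel)"
proof -
  have [measurable]: "{w. G w} \<in> sets noise_algebra" using G by (simp add: pred_def)
  have [measurable]: "{w. F h w} \<in> sets noise_algebra" for h
  proof -
    have "Measurable.pred noise_algebra (\<lambda>w. F h w)"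
      using measurable_compose[OF _ F, of "\<lambda>w. (h, w)" noise_algebra] by simp
    then show ?thesis by (simp add: pred_def)
  qed
  have "(\<integral>\<^sup>+ w. indicator {w. G w} w \<partial>start_at Q x) = (\<integral>\<^sup>+ h. indicator {0..} h * (ennreal (exp (- q x * h)) *
    (\<integral>\<^sup>+ z. K x z * (\<integral>\<^sup>+ w. indicator {p. F (fst p) (snd p)} (h, w) \<partial>start_at Q z) \<partial>count_space UNIV)) \<partial>lborel)"
    using F by (intro nn_integral_first_jump) (auto simp: eq indicator_def pred_def space_pair_measure)
  also have "(\<lambda>h w. indicator {p. F (fst p) (snd p)} (h, w)) = (\<lambda>h w. indicator {w. F h w} w :: ennreal)"
    by (auto simp: indicator_def)
  finally show ?thesis by simp
qed

lemma jump_time_Suc: "jump_time Q (Suc m) w = ennreal (snd (snd w) 0 / q (fst w)) + jump_time Q m (advance w)"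
  by (simp only: jump_time_Suc_advance holding_time_0)

text \<open>A clock can be negative on a null set, and there \<open>ennreal\<close> truncates the
  holding time to 0. The \<open>max 0\<close> follows this truncation, so that the equivalence holds
  for every noise and not only almost surely.\<close>

lemma jump_time_Suc_le_iff:
  assumes "0 \<le> t"
  shows "jump_time Q (Suc m) w \<le> ennreal t \<longleftrightarrow> snd (snd w) 0 / q (fst w) \<le> t \<and>
    jump_time Q m (advance w) \<le> ennreal (t - max 0 (snd (snd w) 0 / q (fst w)))"
proof -
  define h where "h = snd (snd w) 0 / q (fst w)"
  have e: "ennreal h = ennreal (max 0 h)" by (auto simp: max_def ennreal_neg)
  show ?thesis unfolding jump_time_Suc h_def[symmetric]
  proof (cases "h \<le> t")
    case True
    then show "ennreal h + jump_time Q m (advance w) \<le> ennreal t \<longleftrightarrow>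
      h \<le> t \<and> jump_time Q m (advance w) \<le> ennreal (t - max 0 h)"
      unfolding e using assms by (subst ennreal_add_le_ennreal_iff) auto
  next
    case False
    have "ennreal t < ennreal h" using False assms by (simp add: ennreal_lessI)
    then have "\<not> ennreal h + jump_time Q m (advance w) \<le> ennreal t"
      by (metis add_increasing2 leD order.refl order.trans zero_le)
    then show "ennreal h + jump_time Q m (advance w) \<le> ennreal t \<longleftrightarrow>
      h \<le> t \<and> jump_time Q m (advance w) \<le> ennreal (t - max 0 h)" using False by simp
  qed
qed

lemma jump_time_Suc_gt_iff:
  assumes "0 \<le> t"
  shows "ennreal t < jump_time Q (Suc m) w \<longleftrightarrow> t < snd (snd w) 0 / q (fst w) \<or>
    ennreal (t - max 0 (snd (snd w) 0 / q (fst w))) < jump_time Q m (advance w)"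
  unfolding not_le[symmetric] jump_time_Suc_le_iff[OF assms] by auto

lemma sojourn_0: "0 \<le> t \<Longrightarrow> sojourn Q 0 t w \<longleftrightarrow> t < snd (snd w) 0 / q (fst w)"
  using jump_time_Suc_gt_iff[of t 0 w] by (auto simp: sojourn_def)

lemma sojourn_Suc: "0 \<le> t \<Longrightarrow> sojourn Q (Suc m) t w \<longleftrightarrow>
   snd (snd w) 0 / q (fst w) \<le> t \<and> sojourn Q m (t - max 0 (snd (snd w) 0 / q (fst w))) (advance w)"
  unfolding sojourn_def jump_time_Suc_le_iff jump_time_Suc_gt_iff by auto

lemma chain_first_jump:
  assumes t: "0 \<le> t"
  shows "chain Q t w = (if t < snd (snd w) 0 / q (fst w) then Some (fst w)
     else chain Q (t - max 0 (snd (snd w) 0 / q (fst w))) (advance w))"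
proof (cases "t < snd (snd w) 0 / q (fst w)")
  case True
  then have "sojourn Q 0 t w" by (simp add: sojourn_0[OF t])
  then show ?thesis using True by (auto simp: chain_eq_Some_iff intro!: exI[of _ 0])
next
  case False
  then have "\<not> sojourn Q 0 t w" by (simp add: sojourn_0[OF t])
  then have "chain Q t w = Some y \<longleftrightarrow> (\<exists>m. sojourn Q (Suc m) t w \<and> jump_chain (Suc m) w = y)" for y
    unfolding chain_eq_Some_iff by (metis not0_implies_Suc)
  then have "chain Q t w = Some y \<longleftrightarrow>
      chain Q (t - max 0 (snd (snd w) 0 / q (fst w))) (advance w) = Some y" for y
    unfolding chain_eq_Some_iff using False
    by (simp add: sojourn_Suc[OF t] jump_chain_Suc_advance del: jump_chain.simps)
  then have "chain Q t w = chain Q (t - max 0 (snd (snd w) 0 / q (fst w))) (advance w)"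
    by (metis option.exhaust)
  then show ?thesis using False by simp
qed

end

section \<open>Markov property and transition function\<close>

lemma borel_measurable_emeasure_event [measurable (raw)]:
  fixes F :: "'b \<Rightarrow> 's::countable noise \<Rightarrow> bool"
  assumes F [measurable]: "Measurable.pred (M \<Otimes>\<^sub>M noise_algebra) (\<lambda>p. F (fst p) (snd p))"
  shows "(\<lambda>h. emeasure (start_at Q z) {w. F h w}) \<in> borel_measurable M"
proof -
  interpret prob_space "start_at Q z" by (rule prob_space_start_at)
  have "(\<lambda>h. emeasure (start_at Q z) (Pair h -` {p \<in> space (M \<Otimes>\<^sub>M start_at Q z). F (fst p) (snd p)}))
      \<in> borel_measurable M"
    by (rule measurable_emeasure_Pair) measurable
  also have "?this \<longleftrightarrow> ?thesis"
    by (intro measurable_cong arg_cong[where f = "emeasure (start_at Q z)"])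
       (auto simp: space_pair_measure)
  finally show ?thesis .
qed

lemma nn_integral_reflect_atLeastAtMost:
  fixes f :: "real \<Rightarrow> ennreal"
  assumes [measurable]: "f \<in> borel_measurable borel"
  shows "(\<integral>\<^sup>+ h. indicator {0..t} h * f (t - h) \<partial>lborel) = (\<integral>\<^sup>+ h. indicator {0..t} h * f h \<partial>lborel)"
proof -
  have "(\<integral>\<^sup>+ h. indicator {0..t} h * f h \<partial>lborel) =
      ennreal \<bar>-1\<bar> * (\<integral>\<^sup>+ h. indicator {0..t} (t + (-1) * h) * f (t + (-1) * h) \<partial>lborel)"
    by (rule nn_integral_real_affine) auto
  also have "\<dots> = (\<integral>\<^sup>+ h. indicator {0..t} h * f (t - h) \<partial>lborel)"
    by (auto simp: indicator_def intro!: nn_integral_cong)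
  finally show ?thesis by simp
qed

lemma nn_integral_lborel_swap:
  fixes f :: "real \<Rightarrow> real \<Rightarrow> ennreal"
  assumes "case_prod f \<in> borel_measurable (borel \<Otimes>\<^sub>M borel)"
  shows "(\<integral>\<^sup>+ h. \<integral>\<^sup>+ g. f h g \<partial>lborel \<partial>lborel) = (\<integral>\<^sup>+ g. \<integral>\<^sup>+ h. f h g \<partial>lborel \<partial>lborel)"
  by (rule lborel_pair.Fubini'[symmetric]) (use assms in simp)

lemma nn_integral_count_space_swap:
  fixes f :: "'s::countable \<Rightarrow> 'b \<Rightarrow> ennreal"
  assumes "\<And>i. f i \<in> borel_measurable M"
  shows "(\<integral>\<^sup>+ x. \<integral>\<^sup>+ i. f i x \<partial>count_space UNIV \<partial>M) = (\<integral>\<^sup>+ i. \<integral>\<^sup>+ x. f i x \<partial>M \<partial>count_space UNIV)"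
  by (rule nn_integral_count_space_nn_integral) (use assms in auto)

lemma nn_integral_count_space_single:
  "(\<integral>\<^sup>+ z. (if z = a then f z else 0) \<partial>count_space UNIV) = (f a :: ennreal)"
proof -
  have "(\<integral>\<^sup>+ z. (if z = a then f z else 0) \<partial>count_space UNIV) = (\<integral>\<^sup>+ z. f z * indicator {a} z \<partial>count_space UNIV)"
    by (intro nn_integral_cong) (auto split: split_indicator)
  then show ?thesis by simp
qed

context ctmc
begin

text \<open>A finite-dimensional event whose times are counted from \<open>s\<close>. The observed
  values are options because \<open>reversible\<close> also speaks of the value
  \<open>None\<close>.\<close>

definition holds_after :: "real \<Rightarrow> (real \<times> 's option) list \<Rightarrow> 's noise \<Rightarrow> bool" where
  "holds_after s L w \<longleftrightarrow> (\<forall>p\<in>set L. chain Q (s + fst p) w = snd p)"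

text \<open>Past and future of time \<open>s\<close> in one quantity. Recording the number
  \<open>m\<close> of past jumps is what permits induction; an empty list of observations leaves the
  transition function restricted to \<open>m\<close> jumps.\<close>

definition prob_after :: "nat \<Rightarrow> real \<Rightarrow> 's \<Rightarrow> 's \<Rightarrow> (real \<times> 's option) list \<Rightarrow> ennreal" where
  "prob_after m s x y L =
     emeasure (start_at Q x) {w. sojourn Q m s w \<and> jump_chain m w = y \<and> holds_after s L w}"

abbreviation trans_jumps :: "nat \<Rightarrow> real \<Rightarrow> 's \<Rightarrow> 's \<Rightarrow> ennreal" where
  "trans_jumps m t x y \<equiv> prob_after m t x y []"

definition trans_prob :: "real \<Rightarrow> 's \<Rightarrow> 's \<Rightarrow> ennreal" where
  "trans_prob t x y = emeasure (start_at Q x) {w. chain Q t w = Some y}"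

lemma pred_holds_after [measurable]:
  assumes [measurable]: "f \<in> borel_measurable M" "g \<in> M \<rightarrow>\<^sub>M noise_algebra"
  shows "Measurable.pred M (\<lambda>x. holds_after (f x) L (g x))"
  unfolding holds_after_def by measurable

lemma borel_measurable_prob_after [measurable]:
  assumes [measurable]: "f \<in> borel_measurable M"
  shows "(\<lambda>s. prob_after m (f s) x y L) \<in> borel_measurable M"
  unfolding prob_after_def by measurable

lemma pred_sojourn_holds_after:
  "Measurable.pred noise_algebra (\<lambda>w. sojourn Q m s w \<and> jump_chain m w = y \<and> holds_after s L w)"
  by measurable

lemma prob_after_Suc:
  assumes s: "0 \<le> s" and L: "\<forall>p\<in>set L. 0 \<le> fst p"
  shows "prob_after (Suc m) s x y L = (\<integral>\<^sup>+ h. indicator {0..s} h * (ennreal (exp (- q x * h)) *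
    (\<integral>\<^sup>+ z. K x z * prob_after m (s - h) z y L \<partial>count_space UNIV)) \<partial>lborel)"
proof -
  \<comment> \<open>\<open>max 0 h\<close> matches \<open>sojourn_Suc\<close> for every noise; it
    disappears below, where \<open>h\<close> ranges over \<open>{0..s}\<close>.\<close>
  define F where "F h w \<longleftrightarrow> h \<le> s \<and> sojourn Q m (s - max 0 h) w \<and> jump_chain m w = y
     \<and> holds_after (s - max 0 h) L w" for h w
  have "prob_after (Suc m) s x y L = (\<integral>\<^sup>+ h. indicator {0..} h * (ennreal (exp (- q x * h)) *
    (\<integral>\<^sup>+ z. K x z * emeasure (start_at Q z) {w. F h w} \<partial>count_space UNIV)) \<partial>lborel)"
    unfolding prob_after_def
  proof (rule emeasure_first_jump)
    show "Measurable.pred (borel \<Otimes>\<^sub>M noise_algebra) (\<lambda>p. F (fst p) (snd p))"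
      unfolding F_def by measurable
    show "Measurable.pred noise_algebra
      (\<lambda>w. sojourn Q (Suc m) s w \<and> jump_chain (Suc m) w = y \<and> holds_after s L w)"
      by (rule pred_sojourn_holds_after)
    fix w :: "'s noise" assume x: "fst w = x"
    define h where "h = snd (snd w) 0 / q x"
    have "holds_after s L w \<longleftrightarrow> holds_after (s - max 0 h) L (advance w)" if "h \<le> s"
      unfolding holds_after_def
    proof (intro ball_cong refl arg_cong[where f = "\<lambda>c. c = _"])
      fix p assume "p \<in> set L"
      with L have "0 \<le> fst p" by auto
      with s have "chain Q (s + fst p) w = (if s + fst p < h then Some x else chain Q (s + fst p - max 0 h) (advance w))"
        by (subst chain_first_jump) (simp_all add: x h_def)
      with that \<open>0 \<le> fst p\<close> show "chain Q (s + fst p) w = chain Q (s - max 0 h + fst p) (advance w)"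
        by (simp add: algebra_simps)
    qed
    then show "sojourn Q (Suc m) s w \<and> jump_chain (Suc m) w = y \<and> holds_after s L w
        \<longleftrightarrow> F (snd (snd w) 0 / q x) (advance w)"
      unfolding sojourn_Suc[OF s] jump_chain_Suc_advance x F_def h_def[symmetric] by blast
  qed
  also have "\<dots> = (\<integral>\<^sup>+ h. indicator {0..s} h * (ennreal (exp (- q x * h)) *
    (\<integral>\<^sup>+ z. K x z * prob_after m (s - h) z y L \<partial>count_space UNIV)) \<partial>lborel)"
    by (intro nn_integral_cong) (auto simp: F_def prob_after_def split: split_indicator)
  finally show ?thesis .
qed

text \<open>Memorylessness: on the event that the first jump is after \<open>s\<close>, the clock restarts at \<open>s\<close>.\<close>

lemma prob_after_0:
  assumes s: "0 \<le> s" and L: "\<forall>p\<in>set L. 0 \<le> fst p"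
  shows "prob_after 0 s x y L = (if x = y then ennreal (exp (- q x * s)) *
    emeasure (start_at Q x) {w. holds_after 0 L w} else 0)"
proof -
  \<comment> \<open>The observations in \<open>L\<close> for a path that stays in \<open>x\<close>
    until time \<open>r\<close> and then follows the noise \<open>w\<close>. With
    \<open>r = h - s\<close> it describes the future after \<open>s\<close>, with
    \<open>r = h\<close> the future from 0, so that both probabilities are integrals of the same
    \<Phi>.\<close>
  define E where "E r w \<longleftrightarrow> (\<forall>p\<in>set L. (if fst p < r then Some x = snd p
      else chain Q (fst p - max 0 r) w = snd p))" for r w
  define \<Phi> where "\<Phi> r = (\<integral>\<^sup>+ z. K x z * emeasure (start_at Q z) {w. E r w} \<partial>count_space UNIV)" for r
  have pE [measurable]: "Measurable.pred (borel \<Otimes>\<^sub>M noise_algebra) (\<lambda>p. E (f (fst p)) (snd p))"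
    if [measurable]: "f \<in> borel_measurable borel" for f :: "real \<Rightarrow> real" 
    unfolding E_def by measurable
  have [measurable]: "\<Phi> \<in> borel_measurable borel"
    unfolding \<Phi>_def using pE[of "\<lambda>x. x"] by measurable
  have 1: "prob_after 0 s x y L = (\<integral>\<^sup>+ h. indicator {0..} h * (ennreal (exp (- q x * h)) *
    (\<integral>\<^sup>+ z. K x z * emeasure (start_at Q z) {w. s < h \<and> x = y \<and> E (h - s) w} \<partial>count_space UNIV)) \<partial>lborel)"
    unfolding prob_after_def
  proof (rule emeasure_first_jump)
    show "Measurable.pred (borel \<Otimes>\<^sub>M noise_algebra) (\<lambda>p. s < fst p \<and> x = y \<and> E (fst p - s) (snd p))"
      using pE[of "\<lambda>x. x - s"] by measurable
    show "Measurable.pred noise_algebra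
      (\<lambda>w. sojourn Q 0 s w \<and> jump_chain 0 w = y \<and> holds_after s L w)"
      by (rule pred_sojourn_holds_after)
    fix w :: "'s noise" assume x: "fst w = x"
    define h where "h = snd (snd w) 0 / q x"
    have "holds_after s L w \<longleftrightarrow> E (h - s) (advance w)" if "s < h"
      unfolding holds_after_def E_def
    proof (intro ball_cong refl)
      fix p assume "p \<in> set L"
      with L have "0 \<le> fst p" by auto
      with s have ch: "chain Q (s + fst p) w = (if s + fst p < h then Some x else chain Q (s + fst p - max 0 h) (advance w))"
        by (subst chain_first_jump) (simp_all add: x h_def)
      have "s + fst p - max 0 h = fst p - max 0 (h - s)" using that s by simp
      then show "(chain Q (s + fst p) w = snd p) \<longleftrightarrow> (if fst p < h - s then Some x = snd p
          else chain Q (fst p - max 0 (h - s)) (advance w) = snd p)"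
        unfolding ch by (simp only: less_diff_eq add.commute[of s] if_distrib[of "\<lambda>c. c = snd p"])
    qed
    then show "sojourn Q 0 s w \<and> jump_chain 0 w = y \<and> holds_after s L w
        \<longleftrightarrow> s < snd (snd w) 0 / q x \<and> x = y \<and> E (snd (snd w) 0 / q x - s) (advance w)"
      unfolding sojourn_0[OF s] x h_def[symmetric] by (auto simp: x)
  qed
  have 2: "emeasure (start_at Q x) {w. holds_after 0 L w} =
     (\<integral>\<^sup>+ h. indicator {0..} h * (ennreal (exp (- q x * h)) * \<Phi> h) \<partial>lborel)"
    unfolding \<Phi>_def
  proof (rule emeasure_first_jump)
    show "Measurable.pred (borel \<Otimes>\<^sub>M noise_algebra) (\<lambda>p. E (fst p) (snd p))"
      using pE[of "\<lambda>x. x"] by measurable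
    show "Measurable.pred noise_algebra (holds_after 0 L)"
      using pred_holds_after[of "\<lambda>_. 0" noise_algebra "\<lambda>w. w" L] by simp
    fix w :: "'s noise" assume x: "fst w = x"
    show "holds_after 0 L w \<longleftrightarrow> E (snd (snd w) 0 / q x) (advance w)"
      unfolding holds_after_def E_def using L by (intro ball_cong refl) (simp add: chain_first_jump x)
  qed
  show ?thesis
  proof (cases "x = y")
    case True
    have "prob_after 0 s x y L = (\<integral>\<^sup>+ h. indicator {0..} h * (ennreal (exp (- q x * h)) *
        (indicator {s<..} h * \<Phi> (h - s))) \<partial>lborel)"
      unfolding 1 \<Phi>_def using True by (intro nn_integral_cong) (auto split: split_indicator)
    also have "\<dots> = (\<integral>\<^sup>+ r. indicator {0..} (s + r) * (ennreal (exp (- q x * (s + r))) *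
        (indicator {s<..} (s + r) * \<Phi> (s + r - s))) \<partial>lborel)"
      by (subst nn_integral_real_affine[where c = 1 and t = s]) auto
    also have "\<dots> = (\<integral>\<^sup>+ r. ennreal (exp (- q x * s)) * (indicator {0..} r * (ennreal (exp (- q x * r)) * \<Phi> r)) \<partial>lborel)"
      \<comment> \<open>The indicators of \<open>{s<..}\<close> at \<open>s + r\<close> and of
        \<open>{0..}\<close> at \<open>r\<close> differ only at \<open>r = 0\<close>, a null
        set.\<close>
      using AE_lborel_singleton[of 0] s
      by (intro nn_integral_cong_AE)
         (auto elim!: eventually_mono simp: ring_distribs exp_add ennreal_mult mult_ac split: split_indicator)
    also have "\<dots> = ennreal (exp (- q x * s)) * emeasure (start_at Q x) {w. holds_after 0 L w}"
      unfolding 2 by (subst nn_integral_cmult) auto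
    finally show ?thesis using True by simp
  next
    case False
    then show ?thesis unfolding 1 by simp
  qed
qed

lemma holds_after_Nil [simp]: "holds_after s [] = (\<lambda>w. True)"
  by (simp add: holds_after_def fun_eq_iff)

lemma emeasure_start_at_UNIV [simp]: "emeasure (start_at Q x) UNIV = 1"
  using prob_space.emeasure_space_1[OF prob_space_start_at[of Q x]] by simp

lemma trans_jumps_0: "0 \<le> t \<Longrightarrow> trans_jumps 0 t x y = (if x = y then ennreal (exp (- q x * t)) else 0)"
  by (simp add: prob_after_0)

lemma trans_jumps_Suc:
  "0 \<le> t \<Longrightarrow> trans_jumps (Suc m) t x y = (\<integral>\<^sup>+ h. indicator {0..t} h * (ennreal (exp (- q x * h)) *
    (\<integral>\<^sup>+ z. K x z * trans_jumps m (t - h) z y \<partial>count_space UNIV)) \<partial>lborel)"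
  by (rule prob_after_Suc) simp_all

text \<open>The base case is memorylessness. In the induction step the probability of the future
  depends only on the end state \<open>y\<close>, so it leaves the sum over the first jump and the
  integral over its time as a constant factor.\<close>

lemma prob_after_eq:
  assumes "0 \<le> s" and L: "\<forall>p\<in>set L. 0 \<le> fst p"
  shows "prob_after m s x y L = trans_jumps m s x y * emeasure (start_at Q y) {w. holds_after 0 L w}"
  using assms(1)
proof (induction m arbitrary: s x)
  case 0
  then show ?case by (simp add: prob_after_0[OF 0 L] trans_jumps_0)
next
  case (Suc m)
  let ?e = "emeasure (start_at Q y) {w. holds_after 0 L w}"
  have "prob_after (Suc m) s x y L = (\<integral>\<^sup>+ h. indicator {0..s} h * (ennreal (exp (- q x * h)) *
    (\<integral>\<^sup>+ z. K x z * (trans_jumps m (s - h) z y * ?e) \<partial>count_space UNIV)) \<partial>lborel)"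
    unfolding prob_after_Suc[OF Suc.prems L]
    by (intro nn_integral_cong) (auto simp: Suc.IH split: split_indicator)
  also have "\<dots> = (\<integral>\<^sup>+ h. (indicator {0..s} h * (ennreal (exp (- q x * h)) *
    (\<integral>\<^sup>+ z. K x z * trans_jumps m (s - h) z y \<partial>count_space UNIV))) * ?e \<partial>lborel)"
    by (simp add: nn_integral_multc mult.assoc[symmetric])
  also have "\<dots> = trans_jumps (Suc m) s x y * ?e"
    unfolding trans_jumps_Suc[OF Suc.prems] by (subst nn_integral_multc) auto
  finally show ?case .
qed

lemma emeasure_chain_eq_suminf:
  assumes [measurable]: "Measurable.pred noise_algebra A"
  shows "emeasure (start_at Q x) {w. chain Q s w = Some y \<and> A w} =
     (\<Sum>m. emeasure (start_at Q x) {w. sojourn Q m s w \<and> jump_chain m w = y \<and> A w})"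
proof -
  have "emeasure (start_at Q x) {w. chain Q s w = Some y \<and> A w} =
     emeasure (start_at Q x) (\<Union>m. {w. sojourn Q m s w \<and> jump_chain m w = y \<and> A w})"
    by (intro arg_cong[where f = "emeasure (start_at Q x)"]) (auto simp: chain_eq_Some_iff)
  also have "\<dots> = (\<Sum>m. emeasure (start_at Q x) {w. sojourn Q m s w \<and> jump_chain m w = y \<and> A w})"
  proof (rule suminf_emeasure[symmetric])
    have "{w \<in> space noise_algebra. sojourn Q m s w \<and> jump_chain m w = y \<and> A w} \<in> sets noise_algebra" for m
      by measurable
    then show "range (\<lambda>m. {w. sojourn Q m s w \<and> jump_chain m w = y \<and> A w}) \<subseteq> sets (start_at Q x)"
      by auto
    show "disjoint_family (\<lambda>m. {w. sojourn Q m s w \<and> jump_chain m w = y \<and> A w})"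
      by (auto simp: disjoint_family_on_def dest: sojourn_unique)
  qed
  finally show ?thesis .
qed

lemma trans_prob_eq_suminf: "trans_prob t x y = (\<Sum>m. trans_jumps m t x y)"
  using emeasure_chain_eq_suminf[of "\<lambda>_. True" x t y]
  by (simp add: trans_prob_def prob_after_def)

text \<open>Summation over the number of jumps. Non-explosion is not involved, since being in a
  state at time \<open>s\<close> already means that finitely many jumps have occurred.\<close>

lemma markov_property:
  assumes "0 \<le> s" and "\<forall>p\<in>set L. 0 \<le> fst p"
  shows "emeasure (start_at Q x) {w. chain Q s w = Some y \<and> holds_after s L w} =
    trans_prob s x y * emeasure (start_at Q y) {w. holds_after 0 L w}"
  using emeasure_chain_eq_suminf[of "holds_after s L" x s y]
  by (simp add: prob_after_def[symmetric] prob_after_eq[OF assms] trans_prob_eq_suminf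
        pred_holds_after[where f = "\<lambda>_. s" and g = "\<lambda>w. w"])

text \<open>Associativity of convolution: prepending a jump commutes with appending a final factor \<open>c\<close>.\<close>

lemma first_jump_convolution:
  assumes [measurable]: "\<And>v. c v \<in> borel_measurable borel"
  shows "(\<integral>\<^sup>+ h. indicator {0..t} h * (ennreal (exp (- q x * h)) *
      (\<integral>\<^sup>+ z. K x z * (\<integral>\<^sup>+ g. indicator {0..t - h} g *
      (\<integral>\<^sup>+ v. trans_jumps m (t - h - g) z v * c v g \<partial>count_space UNIV) \<partial>lborel) \<partial>count_space UNIV)) \<partial>lborel) =
    (\<integral>\<^sup>+ g. indicator {0..t} g * (\<integral>\<^sup>+ v. trans_jumps (Suc m) (t - g) x v * c v g \<partial>count_space UNIV) \<partial>lborel)"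
proof -
  define T where "T h g z v = indicator {0..t} h * (ennreal (exp (- q x * h)) * (K x z * (indicator {0..t - h} g *
     (trans_jumps m (t - h - g) z v * c v g))))" for h g z v
  have [measurable]: "(\<lambda>p. T (fst p) (snd p) z v) \<in> borel_measurable (borel \<Otimes>\<^sub>M borel)" for z v
    unfolding T_def indicator_def atLeastAtMost_iff by measurable
  have [measurable]: "(\<lambda>h. T h g z v) \<in> borel_measurable borel" "(\<lambda>g. T h g z v) \<in> borel_measurable borel" for h g z v
    unfolding T_def indicator_def atLeastAtMost_iff by measurable
  have "(\<integral>\<^sup>+ h. indicator {0..t} h * (ennreal (exp (- q x * h)) *
    (\<integral>\<^sup>+ z. K x z * (\<integral>\<^sup>+ g. indicator {0..t - h} g *
    (\<integral>\<^sup>+ v. trans_jumps m (t - h - g) z v * c v g \<partial>count_space UNIV) \<partial>lborel) \<partial>count_space UNIV)) \<partial>lborel) = (\<integral>\<^sup>+ h. \<integral>\<^sup>+ z. \<integral>\<^sup>+ g. \<integral>\<^sup>+ v. T h g z v \<partial>count_space UNIV \<partial>lborel \<partial>count_space UNIV \<partial>lborel)"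
    unfolding T_def by (simp add: nn_integral_cmult)
  also have "\<dots> = (\<integral>\<^sup>+ h. \<integral>\<^sup>+ g. \<integral>\<^sup>+ z. \<integral>\<^sup>+ v. T h g z v \<partial>count_space UNIV \<partial>count_space UNIV \<partial>lborel \<partial>lborel)"
    by (subst nn_integral_count_space_swap[symmetric]) auto
  also have "\<dots> = (\<integral>\<^sup>+ g. \<integral>\<^sup>+ h. \<integral>\<^sup>+ z. \<integral>\<^sup>+ v. T h g z v \<partial>count_space UNIV \<partial>count_space UNIV \<partial>lborel \<partial>lborel)"
    by (rule nn_integral_lborel_swap) (simp add: split_beta')
  also have "\<dots> = (\<integral>\<^sup>+ g. \<integral>\<^sup>+ h. \<integral>\<^sup>+ v. \<integral>\<^sup>+ z. T h g z v \<partial>count_space UNIV \<partial>count_space UNIV \<partial>lborel \<partial>lborel)"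
    by (intro nn_integral_cong nn_integral_count_space_swap) auto
  also have "\<dots> = (\<integral>\<^sup>+ g. \<integral>\<^sup>+ v. \<integral>\<^sup>+ h. \<integral>\<^sup>+ z. T h g z v \<partial>count_space UNIV \<partial>lborel \<partial>count_space UNIV \<partial>lborel)"
    by (intro nn_integral_cong nn_integral_count_space_swap) auto
  also have "\<dots> = (\<integral>\<^sup>+ g. \<integral>\<^sup>+ v. \<integral>\<^sup>+ h. \<integral>\<^sup>+ z. indicator {0..t} g * ((indicator {0..t - g} h * (ennreal (exp (- q x * h)) *
       (K x z * trans_jumps m (t - g - h) z v))) * c v g)
       \<partial>count_space UNIV \<partial>lborel \<partial>count_space UNIV \<partial>lborel)"
  proof (intro nn_integral_cong)
    fix g v h z
    \<comment> \<open>Both products are the indicator of the triangle of nonnegative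
      \<open>h\<close> and \<open>g\<close> with \<open>h + g \<le> t\<close>.\<close>
    have "indicator {0..t} h * indicator {0..t - h} g = (indicator {0..t} g * indicator {0..t - g} h :: ennreal)"
      by (auto split: split_indicator)
    moreover have "t - h - g = t - g - h" by simp
    moreover have "T h g z v = (indicator {0..t} h * indicator {0..t - h} g) * (ennreal (exp (- q x * h)) * (K x z *
     (trans_jumps m (t - h - g) z v * c v g)))"
      unfolding T_def by (simp only: mult_ac)
    ultimately have "T h g z v = (indicator {0..t} g * indicator {0..t - g} h) * (ennreal (exp (- q x * h)) * (K x z *
     (trans_jumps m (t - g - h) z v * c v g)))"
      by (simp only:)
    then show "T h g z v = indicator {0..t} g * ((indicator {0..t - g} h * (ennreal (exp (- q x * h)) *
       (K x z * trans_jumps m (t - g - h) z v))) * c v g)"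
      by (simp only: mult_ac)
  qed
  also have "\<dots> = (\<integral>\<^sup>+ g. indicator {0..t} g * (\<integral>\<^sup>+ v. (\<integral>\<^sup>+ h. indicator {0..t - g} h * (ennreal (exp (- q x * h)) *
       (\<integral>\<^sup>+ z. K x z * trans_jumps m (t - g - h) z v \<partial>count_space UNIV)) \<partial>lborel) * c v g
        \<partial>count_space UNIV) \<partial>lborel)"
    by (simp add: nn_integral_cmult nn_integral_multc)
  also have "\<dots> = (\<integral>\<^sup>+ g. indicator {0..t} g * (\<integral>\<^sup>+ v. trans_jumps (Suc m) (t - g) x v * c v g
        \<partial>count_space UNIV) \<partial>lborel)"
    by (intro nn_integral_cong) (auto simp: trans_jumps_Suc split: split_indicator)
  finally show ?thesis .
qed

text \<open>The equation at the last jump, with \<open>h\<close> the time elapsed since then. It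
  follows from the equation at the first jump by taking \<open>K v y * exp (- q y * g)\<close> as
  the final factor of the convolution.\<close>

lemma trans_jumps_Suc_last:
  "0 \<le> t \<Longrightarrow> trans_jumps (Suc m) t x y = (\<integral>\<^sup>+ h. indicator {0..t} h *
    (\<integral>\<^sup>+ z. trans_jumps m (t - h) x z * (K z y * ennreal (exp (- q y * h))) \<partial>count_space UNIV) \<partial>lborel)"
proof (induction m arbitrary: t x)
  case 0
  have "trans_jumps (Suc 0) t x y = (\<integral>\<^sup>+ h. indicator {0..t} h * (ennreal (exp (- q x * h)) *
    (\<integral>\<^sup>+ z. (if z = y then K x z * ennreal (exp (- q z * (t - h))) else 0) \<partial>count_space UNIV)) \<partial>lborel)"
    unfolding trans_jumps_Suc[OF 0]
    by (intro nn_integral_cong) (auto simp: trans_jumps_0 if_distrib cong: if_cong split: split_indicator)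
  also have "\<dots> = (\<integral>\<^sup>+ h. indicator {0..t} h * (ennreal (exp (- q x * h)) * (K x y * ennreal (exp (- q y * (t - h))))) \<partial>lborel)"
    by (simp add: nn_integral_count_space_single)
  \<comment> \<open>Writing \<open>h\<close> as \<open>t - (t - h)\<close> makes the integrand a
    function of \<open>t - h\<close>, as the reflection of the interval requires.\<close>
  also have "\<dots> = (\<integral>\<^sup>+ h. indicator {0..t} h * (ennreal (exp (- q x * (t - (t - h)))) * (K x y * ennreal (exp (- q y * (t - h))))) \<partial>lborel)"
    by simp
  also have "\<dots> = (\<integral>\<^sup>+ h. indicator {0..t} h * (ennreal (exp (- q x * (t - h))) * (K x y * ennreal (exp (- q y * h)))) \<partial>lborel)"
    by (rule nn_integral_reflect_atLeastAtMost) auto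
  also have "\<dots> = (\<integral>\<^sup>+ h. indicator {0..t} h *
    (\<integral>\<^sup>+ z. (if z = x then ennreal (exp (- q z * (t - h))) * (K z y * ennreal (exp (- q y * h))) else 0) \<partial>count_space UNIV) \<partial>lborel)"
    by (simp add: nn_integral_count_space_single)
  also have "\<dots> = (\<integral>\<^sup>+ h. indicator {0..t} h *
    (\<integral>\<^sup>+ z. trans_jumps 0 (t - h) x z * (K z y * ennreal (exp (- q y * h))) \<partial>count_space UNIV) \<partial>lborel)"
    by (intro nn_integral_cong) (auto simp: trans_jumps_0 intro!: nn_integral_cong split: split_indicator)
  finally show ?case .
next
  case (Suc m)
  have "trans_jumps (Suc (Suc m)) t x y = (\<integral>\<^sup>+ h. indicator {0..t} h * (ennreal (exp (- q x * h)) *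
    (\<integral>\<^sup>+ z. K x z * (\<integral>\<^sup>+ g. indicator {0..t - h} g *
    (\<integral>\<^sup>+ v. trans_jumps m (t - h - g) z v * (K v y * ennreal (exp (- q y * g))) \<partial>count_space UNIV) \<partial>lborel) \<partial>count_space UNIV)) \<partial>lborel)"
    unfolding trans_jumps_Suc[OF Suc.prems]
    by (intro nn_integral_cong) (auto simp: Suc.IH split: split_indicator)
  also note first_jump_convolution
  finally show ?case by simp
qed

end

section \<open>Reversible chains: non-explosion and the stationary law\<close>

lemma emeasure_chain_space:
  assumes A [measurable]: "Measurable.pred noise_algebra A"
  shows "emeasure (chain_space Q p) {w. A w} =
    (\<integral>\<^sup>+ x. ennreal (pmf p x) * emeasure (start_at Q x) {w. A w} \<partial>count_space UNIV)"
proof -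
  have [measurable]: "{w. A w} \<in> sets noise_algebra" using A by (simp add: pred_def)
  have "(\<integral>\<^sup>+ w. indicator {w. A w} w \<partial>chain_space Q p) =
      (\<integral>\<^sup>+ x. \<integral>\<^sup>+ w. indicator {w. A w} w \<partial>start_at Q x \<partial>measure_pmf p)"
    by (rule nn_integral_chain_space_start_at) measurable
  then show ?thesis by (simp add: nn_integral_measure_pmf)
qed

text \<open>The difference \<open>g x - f x\<close> is nonnegative with total mass 0; finiteness
  makes the subtraction in \<open>ennreal\<close> faithful. Uniqueness of the stationary law rests
  on this equality case.\<close>

lemma nn_integral_count_space_eq_pointwise:
  fixes f g :: "'b \<Rightarrow> ennreal"
  assumes le: "\<And>x. f x \<le> g x" and eq: "(\<integral>\<^sup>+ x. g x \<partial>count_space UNIV) \<le> (\<integral>\<^sup>+ x. f x \<partial>count_space UNIV)"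
    and fin: "(\<integral>\<^sup>+ x. f x \<partial>count_space UNIV) < \<infinity>"
  shows "f x = g x"
proof -
  have "(\<integral>\<^sup>+ x. g x - f x \<partial>count_space UNIV) = (\<integral>\<^sup>+ x. g x \<partial>count_space UNIV) - (\<integral>\<^sup>+ x. f x \<partial>count_space UNIV)"
    using fin le by (intro nn_integral_diff) (auto simp: AE_count_space)
  also have "\<dots> = 0" using eq le_less_trans[OF eq fin] by (simp add: diff_eq_0_iff_ennreal)
  finally have "g x - f x = 0" by (simp add: nn_integral_0_iff_AE AE_count_space)
  moreover have "f x < \<infinity>"
    using fin nn_integral_ge_point[of x UNIV f] by (auto simp: top_unique less_top[symmetric])
  ultimately have "g x \<le> f x" by (auto simp: diff_eq_0_iff_ennreal)
  then show ?thesis using le[of x] by simp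
qed

context ctmc
begin

lemma pred_le_jump_time [measurable]: "Measurable.pred noise_algebra (\<lambda>w. jump_time Q m w \<le> ennreal t)"
  by measurable

lemma emeasure_jump_time_Suc:
  assumes t: "0 \<le> t"
  shows "emeasure (start_at Q x) {w. jump_time Q (Suc m) w \<le> ennreal t} =
    (\<integral>\<^sup>+ h. indicator {0..t} h * (ennreal (exp (- q x * h)) *
      (\<integral>\<^sup>+ z. K x z * emeasure (start_at Q z) {w. jump_time Q m w \<le> ennreal (t - h)} \<partial>count_space UNIV)) \<partial>lborel)"
proof -
  have "emeasure (start_at Q x) {w. jump_time Q (Suc m) w \<le> ennreal t} =
    (\<integral>\<^sup>+ h. indicator {0..} h * (ennreal (exp (- q x * h)) *
      (\<integral>\<^sup>+ z. K x z * emeasure (start_at Q z) {w. h \<le> t \<and> jump_time Q m w \<le> ennreal (t - max 0 h)} \<partial>count_space UNIV)) \<partial>lborel)"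
    by (rule emeasure_first_jump) (auto simp: jump_time_Suc_le_iff[OF t])
  also have "\<dots> = (\<integral>\<^sup>+ h. indicator {0..t} h * (ennreal (exp (- q x * h)) *
      (\<integral>\<^sup>+ z. K x z * emeasure (start_at Q z) {w. jump_time Q m w \<le> ennreal (t - h)} \<partial>count_space UNIV)) \<partial>lborel)"
    by (intro nn_integral_cong) (auto split: split_indicator)
  finally show ?thesis .
qed

text \<open>The inner sum is the density of the jump number \<open>Suc m\<close> at time
  \<open>t - h\<close>: by then exactly \<open>m\<close> jumps have been made, and the current state
  \<open>y\<close> is left at rate \<open>q y\<close>. This expresses jump counts through
  \<open>trans_jumps\<close>, the quantity to which symmetry applies.\<close>

lemma emeasure_jump_time_eq:
  "0 \<le> t \<Longrightarrow> emeasure (start_at Q x) {w. jump_time Q (Suc m) w \<le> ennreal t} =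
    (\<integral>\<^sup>+ h. indicator {0..t} h * (\<integral>\<^sup>+ y. trans_jumps m (t - h) x y * ennreal (q y) \<partial>count_space UNIV) \<partial>lborel)"
proof (induction m arbitrary: t x)
  case 0
  have "emeasure (start_at Q x) {w. jump_time Q (Suc 0) w \<le> ennreal t} =
     (\<integral>\<^sup>+ h. indicator {0..t} h * (ennreal (exp (- q x * h)) * ennreal (q x)) \<partial>lborel)"
    unfolding emeasure_jump_time_Suc[OF 0] by (simp add: nn_integral_K)
  also have "\<dots> = (\<integral>\<^sup>+ h. indicator {0..t} h * (ennreal (exp (- q x * (t - h))) * ennreal (q x)) \<partial>lborel)"
    by (rule nn_integral_reflect_atLeastAtMost[symmetric]) measurable
  also have "\<dots> = (\<integral>\<^sup>+ h. indicator {0..t} h *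
     (\<integral>\<^sup>+ y. (if y = x then ennreal (exp (- q x * (t - h))) * ennreal (q y) else 0) \<partial>count_space UNIV) \<partial>lborel)"
    by (simp add: nn_integral_count_space_single)
  also have "\<dots> = (\<integral>\<^sup>+ h. indicator {0..t} h * (\<integral>\<^sup>+ y. trans_jumps 0 (t - h) x y * ennreal (q y) \<partial>count_space UNIV) \<partial>lborel)"
    by (intro nn_integral_cong) (auto simp: trans_jumps_0 intro!: nn_integral_cong split: split_indicator)
  finally show ?case .
next
  case (Suc m)
  have "emeasure (start_at Q x) {w. jump_time Q (Suc (Suc m)) w \<le> ennreal t} =
    (\<integral>\<^sup>+ h. indicator {0..t} h * (ennreal (exp (- q x * h)) *
      (\<integral>\<^sup>+ z. K x z * (\<integral>\<^sup>+ g. indicator {0..t - h} g *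
      (\<integral>\<^sup>+ v. trans_jumps m (t - h - g) z v * ennreal (q v) \<partial>count_space UNIV) \<partial>lborel) \<partial>count_space UNIV)) \<partial>lborel)"
    unfolding emeasure_jump_time_Suc[OF Suc.prems]
    by (intro nn_integral_cong) (auto simp: Suc.IH split: split_indicator)
  also note first_jump_convolution
  finally show ?case by simp
qed

text \<open>The defect of a row sum from 1 is the probability of explosion. This separates the bound
  by 1, always available, from equality, available only after non-explosion.\<close>

lemma nn_integral_trans_prob: "(\<integral>\<^sup>+ y. trans_prob t x y \<partial>count_space UNIV) =
    emeasure (start_at Q x) {w. chain Q t w \<noteq> None}"
proof -
  have [measurable]: "{w. chain Q t w = c} \<in> sets noise_algebra" for c
    using pred_chain[of "\<lambda>_. t" noise_algebra "\<lambda>w. w" Q c] by (simp add: pred_def)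
  have [measurable]: "{w. chain Q t w \<noteq> c} \<in> sets noise_algebra" for c
    using sets.compl_sets[of "{w. chain Q t w = c}" noise_algebra] by (simp add: Collect_neg_eq Compl_eq_Diff_UNIV)
  have "(\<integral>\<^sup>+ y. trans_prob t x y \<partial>count_space UNIV) =
    (\<integral>\<^sup>+ y. \<integral>\<^sup>+ w. indicator {w. chain Q t w = Some y} w \<partial>start_at Q x \<partial>count_space UNIV)"
    by (simp add: trans_prob_def)
  also have "\<dots> = (\<integral>\<^sup>+ w. \<integral>\<^sup>+ y. indicator {w. chain Q t w = Some y} w \<partial>count_space UNIV \<partial>start_at Q x)"
    by (rule nn_integral_count_space_swap[symmetric]) measurable
  also have "\<dots> = (\<integral>\<^sup>+ w. indicator {w. chain Q t w \<noteq> None} w \<partial>start_at Q x)"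
  proof (intro nn_integral_cong)
    fix w
    show "(\<integral>\<^sup>+ y. indicator {w. chain Q t w = Some y} w \<partial>count_space UNIV) = (indicator {w. chain Q t w \<noteq> None} w :: ennreal)"
    proof (cases "chain Q t w")
      case (Some z)
      then have "(\<integral>\<^sup>+ y. indicator {w. chain Q t w = Some y} w \<partial>count_space UNIV) =
         (\<integral>\<^sup>+ y. (if y = z then 1 else 0 :: ennreal) \<partial>count_space UNIV)"
        by (intro nn_integral_cong) (auto split: split_indicator)
      then show ?thesis using Some by (simp add: nn_integral_count_space_single)
    qed simp
  qed
  also have "\<dots> = emeasure (start_at Q x) {w. chain Q t w \<noteq> None}"
    by (rule nn_integral_indicator) measurable
  finally show ?thesis .
qed

lemma trans_prob_pos:
  assumes xy: "x \<noteq> y" and Q: "0 < Q x y"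
  shows "0 < trans_prob 1 x y"
proof -
  \<comment> \<open>A path with a single jump at time \<open>h\<close> in \<open>{0..1}\<close> has
    density \<open>exp (- q x * h) * Q x y * exp (- q y * (1 - h))\<close>; bounding both holding
    periods by the full unit of time gives \<open>?c\<close>.\<close>
  let ?c = "exp (- q x) * (Q x y * exp (- q y))"
  have "0 < ennreal ?c" using Q by simp
  also have "ennreal ?c = (\<integral>\<^sup>+ h. indicator {0..1::real} h * ennreal ?c \<partial>lborel)"
    by (subst nn_integral_multc) auto
  also have "\<dots> \<le> (\<integral>\<^sup>+ h. indicator {0..1} h * (ennreal (exp (- q x * h)) *
      (\<integral>\<^sup>+ z. K x z * trans_jumps 0 (1 - h) z y \<partial>count_space UNIV)) \<partial>lborel)"
  proof (intro nn_integral_mono)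
    fix h :: real
    show "indicator {0..1} h * ennreal ?c \<le> indicator {0..1} h * (ennreal (exp (- q x * h)) *
      (\<integral>\<^sup>+ z. K x z * trans_jumps 0 (1 - h) z y \<partial>count_space UNIV))"
    proof (cases "h \<in> {0..1}")
      case True
      have "ennreal ?c \<le> ennreal (exp (- q x * h) * (Q x y * exp (- q y * (1 - h))))"
        using True Q q_pos[of x] q_pos[of y]
        by (intro ennreal_leI mult_mono) (auto simp: mult_le_cancel_left1 mult_le_cancel_left2)
      also have "\<dots> = ennreal (exp (- q x * h)) * (K x y * trans_jumps 0 (1 - h) y y)"
        using True Q xy by (simp add: trans_jumps_0 K_def ennreal_mult)
      also have "\<dots> \<le> ennreal (exp (- q x * h)) * (\<integral>\<^sup>+ z. K x z * trans_jumps 0 (1 - h) z y \<partial>count_space UNIV)"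
        by (intro mult_left_mono nn_integral_ge_point) auto
      finally show ?thesis using True by simp
    qed simp
  qed
  also have "\<dots> = trans_jumps (Suc 0) 1 x y" by (rule trans_jumps_Suc[symmetric]) simp
  also have "\<dots> \<le> trans_prob 1 x y"
    unfolding trans_prob_eq_suminf using sum_le_suminf[of "\<lambda>m. trans_jumps m 1 x y" "{Suc 0}"] by simp
  finally show ?thesis .
qed

lemma stationary_iff:
  "stationary Q p \<longleftrightarrow> (\<forall>t\<ge>0. \<forall>x. (\<integral>\<^sup>+ y. ennreal (pmf p y) * trans_prob t y x \<partial>count_space UNIV) = ennreal (pmf p x))"
proof -
  interpret S: prob_space "chain_space Q p" by (rule prob_space_chain_space)
  have "(\<integral>\<^sup>+ y. ennreal (pmf p y) * trans_prob t y x \<partial>count_space UNIV) =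
      ennreal (measure (chain_space Q p) {w \<in> space (chain_space Q p). chain Q t w = Some x})" for t x
    unfolding S.emeasure_eq_measure[symmetric] trans_prob_def
    by (simp add: emeasure_chain_space pred_chain[where f = "\<lambda>_. t" and g = "\<lambda>w. w"])
  then show ?thesis by (simp add: stationary_def)
qed

end

text \<open>Detailed balance with a probability measure does not by itself exclude explosion;
  \<open>finite_mean_rate\<close> is the assumption that does.\<close>

locale reversible_ctmc = ctmc Q for Q :: "'s::countable \<Rightarrow> 's \<Rightarrow> real" +
  fixes \<pi> :: "'s pmf"
  assumes pmf_\<pi>_pos: "0 < pmf \<pi> x"
    and detailed_balance: "pmf \<pi> x * Q x y = pmf \<pi> y * Q y x"
    and finite_mean_rate: "(\<integral>\<^sup>+ x. ennreal (- Q x x) \<partial>measure_pmf \<pi>) < \<infinity>"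
    and irreducible: "(x, y) \<in> {(x, y). x \<noteq> y \<and> 0 < Q x y}\<^sup>*"
begin

abbreviation wt :: "'s \<Rightarrow> ennreal" where "wt x \<equiv> ennreal (pmf \<pi> x)"

lemma wt_pos: "0 < wt x" using pmf_\<pi>_pos[of x] by simp

lemma balance_K: "wt x * K x y = wt y * K y x"
  using detailed_balance[of x y] rate_nonneg[of x y] rate_nonneg[of y x]
  by (auto simp: K_def ennreal_mult[symmetric])

lemma nn_integral_wt: "(\<integral>\<^sup>+ x. wt x \<partial>count_space UNIV) = 1"
  by (rule nn_integral_pmf_eq_1)

text \<open>The left side is expanded at the first jump and the right side at the last one. Detailed
  balance moves the weight across that jump, and the induction hypothesis moves it across the
  remaining \<open>m\<close> jumps.\<close>

lemma trans_jumps_sym: "0 \<le> t \<Longrightarrow> wt x * trans_jumps m t x y = wt y * trans_jumps m t y x"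
proof (induction m arbitrary: t x y)
  case 0
  then show ?case by (simp add: trans_jumps_0)
next
  case (Suc m)
  have "wt x * trans_jumps (Suc m) t x y = (\<integral>\<^sup>+ h. indicator {0..t} h *
     (\<integral>\<^sup>+ z. ennreal (exp (- q x * h)) * ((wt x * K x z) * trans_jumps m (t - h) z y) \<partial>count_space UNIV) \<partial>lborel)"
    unfolding trans_jumps_Suc[OF Suc.prems]
    by (simp add: nn_integral_cmult[symmetric] mult_ac)
  also have "\<dots> = (\<integral>\<^sup>+ h. indicator {0..t} h *
     (\<integral>\<^sup>+ z. wt y * (trans_jumps m (t - h) y z * (K z x * ennreal (exp (- q x * h)))) \<partial>count_space UNIV) \<partial>lborel)"
  proof (intro nn_integral_cong)
    fix h
    show "indicator {0..t} h * (\<integral>\<^sup>+ z. ennreal (exp (- q x * h)) * ((wt x * K x z) * trans_jumps m (t - h) z y) \<partial>count_space UNIV)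
      = indicator {0..t} h * (\<integral>\<^sup>+ z. wt y * (trans_jumps m (t - h) y z * (K z x * ennreal (exp (- q x * h)))) \<partial>count_space UNIV)"
    proof (cases "h \<in> {0..t}")
      case True
      have "ennreal (exp (- q x * h)) * ((wt x * K x z) * trans_jumps m (t - h) z y) =
         wt y * (trans_jumps m (t - h) y z * (K z x * ennreal (exp (- q x * h))))" for z
      proof -
        have "(wt x * K x z) * trans_jumps m (t - h) z y = K z x * (wt z * trans_jumps m (t - h) z y)"
          unfolding balance_K[of x z] by (simp only: mult_ac)
        also have "wt z * trans_jumps m (t - h) z y = wt y * trans_jumps m (t - h) y z"
          using True by (intro Suc.IH) auto
        finally show ?thesis by (simp only: mult_ac)
      qed
      then show ?thesis by simp
    qed simp
  qed
  also have "\<dots> = wt y * trans_jumps (Suc m) t y x"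
    unfolding trans_jumps_Suc_last[OF Suc.prems]
    by (simp add: nn_integral_cmult[symmetric] mult.left_commute)
  finally show ?case .
qed

lemma trans_prob_sym: "0 \<le> t \<Longrightarrow> wt x * trans_prob t x y = wt y * trans_prob t y x"
  by (simp add: trans_prob_eq_suminf ennreal_suminf_cmult[symmetric] trans_jumps_sym del: ennreal_suminf_cmult)

lemma wt_q_finite: "(\<integral>\<^sup>+ x. wt x * ennreal (q x) \<partial>count_space UNIV) < \<infinity>"
  using finite_mean_rate by (simp add: nn_integral_measure_pmf)

text \<open>
  The expected number of jumps before \<open>t\<close> of the chain started from \<open>\<pi>\<close> is at most \<open>t\<close> times the mean
  exit rate, since \<open>\<pi>\<close> is subinvariant by symmetry.
\<close>

lemma suminf_jumps_finite:
  assumes t: "0 \<le> t"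
  shows "(\<Sum>m. \<integral>\<^sup>+ x. wt x * emeasure (start_at Q x) {w. jump_time Q (Suc m) w \<le> ennreal t} \<partial>count_space UNIV) < \<infinity>"
proof -
  define C where "C = (\<integral>\<^sup>+ x. wt x * ennreal (q x) \<partial>count_space UNIV)"
  have "(\<integral>\<^sup>+ x. wt x * emeasure (start_at Q x) {w. jump_time Q (Suc m) w \<le> ennreal t} \<partial>count_space UNIV) =
     (\<integral>\<^sup>+ h. indicator {0..t} h * (\<integral>\<^sup>+ y. (wt y * ennreal (q y)) *
       (\<integral>\<^sup>+ x. trans_jumps m (t - h) y x \<partial>count_space UNIV) \<partial>count_space UNIV) \<partial>lborel)" for m
  proof -
    have "(\<integral>\<^sup>+ x. wt x * emeasure (start_at Q x) {w. jump_time Q (Suc m) w \<le> ennreal t} \<partial>count_space UNIV) =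
      (\<integral>\<^sup>+ x. \<integral>\<^sup>+ h. \<integral>\<^sup>+ y. indicator {0..t} h * (wt x * (trans_jumps m (t - h) x y * ennreal (q y)))
         \<partial>count_space UNIV \<partial>lborel \<partial>count_space UNIV)"
      unfolding emeasure_jump_time_eq[OF t] by (simp add: nn_integral_cmult[symmetric] mult_ac)
    also have "\<dots> = (\<integral>\<^sup>+ h. \<integral>\<^sup>+ x. \<integral>\<^sup>+ y. indicator {0..t} h * (wt x * (trans_jumps m (t - h) x y * ennreal (q y)))
         \<partial>count_space UNIV \<partial>count_space UNIV \<partial>lborel)"
      by (rule nn_integral_count_space_swap[symmetric]) measurable
    also have "\<dots> = (\<integral>\<^sup>+ h. \<integral>\<^sup>+ y. \<integral>\<^sup>+ x. indicator {0..t} h * (wt x * (trans_jumps m (t - h) x y * ennreal (q y)))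
         \<partial>count_space UNIV \<partial>count_space UNIV \<partial>lborel)"
      by (intro nn_integral_cong nn_integral_count_space_swap) auto
    also have "\<dots> = (\<integral>\<^sup>+ h. \<integral>\<^sup>+ y. \<integral>\<^sup>+ x. indicator {0..t} h * ((wt y * ennreal (q y)) * trans_jumps m (t - h) y x)
         \<partial>count_space UNIV \<partial>count_space UNIV \<partial>lborel)"
    proof (intro nn_integral_cong)
      fix h y x
      show "indicator {0..t} h * (wt x * (trans_jumps m (t - h) x y * ennreal (q y))) =
        indicator {0..t} h * ((wt y * ennreal (q y)) * trans_jumps m (t - h) y x)"
      proof (cases "h \<in> {0..t}")
        case True
        then have "wt x * trans_jumps m (t - h) x y = wt y * trans_jumps m (t - h) y x"
          by (intro trans_jumps_sym) auto
        then have "(wt x * trans_jumps m (t - h) x y) * ennreal (q y) = (wt y * trans_jumps m (t - h) y x) * ennreal (q y)"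
          by simp
        then have "wt x * (trans_jumps m (t - h) x y * ennreal (q y)) = (wt y * ennreal (q y)) * trans_jumps m (t - h) y x"
          by (simp only: mult_ac)
        then show ?thesis by simp
      qed simp
    qed
    also have "\<dots> = (\<integral>\<^sup>+ h. indicator {0..t} h * (\<integral>\<^sup>+ y. (wt y * ennreal (q y)) *
       (\<integral>\<^sup>+ x. trans_jumps m (t - h) y x \<partial>count_space UNIV) \<partial>count_space UNIV) \<partial>lborel)"
      by (simp add: nn_integral_cmult)
    finally show ?thesis .
  qed
  \<comment> \<open>Symmetry has moved the rate to the starting state. Summing over \<open>m\<close>
    and then over the end state leaves a row sum of \<open>trans_prob\<close>, which is at most 1 in
    any case.\<close>
  then have "(\<Sum>m. \<integral>\<^sup>+ x. wt x * emeasure (start_at Q x) {w. jump_time Q (Suc m) w \<le> ennreal t} \<partial>count_space UNIV) =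
     (\<integral>\<^sup>+ h. indicator {0..t} h * (\<integral>\<^sup>+ y. (wt y * ennreal (q y)) *
       (\<integral>\<^sup>+ x. trans_prob (t - h) y x \<partial>count_space UNIV) \<partial>count_space UNIV) \<partial>lborel)"
    unfolding trans_prob_eq_suminf by (simp add: nn_integral_suminf[symmetric])
  also have "\<dots> \<le> (\<integral>\<^sup>+ h. indicator {0..t} h * C \<partial>lborel)"
    unfolding C_def
  proof (intro nn_integral_mono mult_left_mono)
    fix h y
    have "(\<integral>\<^sup>+ x. trans_prob (t - h) y x \<partial>count_space UNIV) \<le> 1"
      unfolding nn_integral_trans_prob using prob_space.emeasure_le_1[OF prob_space_start_at] .
    then show "(wt y * ennreal (q y)) * (\<integral>\<^sup>+ x. trans_prob (t - h) y x \<partial>count_space UNIV) \<le> wt y * ennreal (q y)"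
      using mult_left_mono[of _ 1 "wt y * ennreal (q y)"] by simp
  qed simp
  also have "\<dots> = ennreal t * C" using t by (subst nn_integral_multc) auto
  also have "\<dots> < \<infinity>" using wt_q_finite by (simp add: C_def ennreal_mult_less_top)
  finally show ?thesis .
qed

text \<open>Explosion before \<open>t\<close> puts the same mass \<open>c\<close> into every term of
  a convergent series, so \<open>c\<close> vanishes; since every state has positive weight, this
  holds from each starting state and not only under \<pi>.\<close>

lemma emeasure_explosion:
  assumes t: "0 \<le> t"
  shows "emeasure (start_at Q x) {w. \<forall>m. jump_time Q (Suc m) w \<le> ennreal t} = 0"
proof -
  have [measurable]: "{w. jump_time Q m w \<le> ennreal t} \<in> sets noise_algebra" for m
    using pred_le_jump_time[of m t] by (simp add: pred_def)
  define c where "c = wt x * emeasure (start_at Q x) {w. \<forall>m. jump_time Q (Suc m) w \<le> ennreal t}"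
  have "c \<le> (\<integral>\<^sup>+ x. wt x * emeasure (start_at Q x) {w. jump_time Q (Suc m) w \<le> ennreal t} \<partial>count_space UNIV)" for m
  proof -
    have "c \<le> wt x * emeasure (start_at Q x) {w. jump_time Q (Suc m) w \<le> ennreal t}"
      unfolding c_def by (intro mult_left_mono emeasure_mono) auto
    also have "\<dots> \<le> (\<integral>\<^sup>+ x. wt x * emeasure (start_at Q x) {w. jump_time Q (Suc m) w \<le> ennreal t} \<partial>count_space UNIV)"
      by (rule nn_integral_ge_point) simp
    finally show ?thesis .
  qed
  then have "(\<Sum>m::nat. c) \<le> (\<Sum>m. \<integral>\<^sup>+ x. wt x * emeasure (start_at Q x) {w. jump_time Q (Suc m) w \<le> ennreal t} \<partial>count_space UNIV)"
    by (intro suminf_le) auto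
  then have "(\<integral>\<^sup>+ m. c \<partial>count_space (UNIV :: nat set)) < \<infinity>"
    unfolding nn_integral_count_space_nat using suminf_jumps_finite[OF t] by (rule le_less_trans)
  then have "c = 0" by (cases "c = 0") (auto simp: ennreal_mult_top)
  then show ?thesis using wt_pos[of x] by (simp add: c_def)
qed

lemma emeasure_chain_None: "0 \<le> t \<Longrightarrow> emeasure (start_at Q x) {w. chain Q t w = None} = 0"
  unfolding chain_eq_None_iff by (rule emeasure_explosion)

lemma nn_integral_trans_prob_eq_1:
  assumes "0 \<le> t" shows "(\<integral>\<^sup>+ y. trans_prob t x y \<partial>count_space UNIV) = 1"
proof -
  have m: "{w. chain Q t w = None} \<in> sets (start_at Q x)"
    using pred_chain[of "\<lambda>_. t" noise_algebra "\<lambda>w. w" Q None] by (simp add: pred_def)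
  have "emeasure (start_at Q x) (space (start_at Q x) - {w. chain Q t w = None}) = 1"
    using m by (subst emeasure_compl) (simp_all add: emeasure_chain_None[OF assms])
  moreover have "UNIV - {w. chain Q t w = None} = {w. chain Q t w \<noteq> None}" by auto
  ultimately show ?thesis unfolding nn_integral_trans_prob space_start_at by (simp only:)
qed

lemma stationary_\<pi>: "stationary Q \<pi>"
  unfolding stationary_iff
  by (auto simp: trans_prob_sym[of _ _ x for x] nn_integral_cmult nn_integral_trans_prob_eq_1)

text \<open>The single kernel \<open>trans_prob 1\<close> suffices: it charges every edge of the
  rate graph by \<open>trans_prob_pos\<close>, so irreducibility of the rates can be used
  directly.\<close>

lemma stationary_unique:
  assumes "stationary Q \<nu>" shows "\<nu> = \<pi>"
proof -
  define nu where "nu x = ennreal (pmf \<nu> x)" for x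
  define \<eta> where "\<eta> x = min (nu x) (wt x)" for x
  have nu1: "(\<integral>\<^sup>+ x. nu x \<partial>count_space UNIV) = 1" unfolding nu_def by (rule nn_integral_pmf_eq_1)
  have nuP: "(\<integral>\<^sup>+ y. nu y * trans_prob 1 y x \<partial>count_space UNIV) = nu x" for x
    using assms by (simp add: stationary_iff nu_def)
  have piP: "(\<integral>\<^sup>+ y. wt y * trans_prob 1 y x \<partial>count_space UNIV) = wt x" for x
    using stationary_\<pi> by (simp add: stationary_iff)
  have fin: "(\<integral>\<^sup>+ x. \<eta> x \<partial>count_space UNIV) < \<infinity>"
  proof -
    have "(\<integral>\<^sup>+ x. \<eta> x \<partial>count_space UNIV) \<le> (\<integral>\<^sup>+ x. wt x \<partial>count_space UNIV)"
      by (intro nn_integral_mono) (simp add: \<eta>_def)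
    also have "\<dots> < \<infinity>" by (simp add: nn_integral_wt)
    finally show ?thesis .
  qed
  \<comment> \<open>Row sums equal to 1 preserve the mass of \<eta>, so the pointwise inequality in
    the next step is an equality.\<close>
  have mass: "(\<integral>\<^sup>+ x. \<integral>\<^sup>+ y. \<eta> y * trans_prob 1 y x \<partial>count_space UNIV \<partial>count_space UNIV) = (\<integral>\<^sup>+ y. \<eta> y \<partial>count_space UNIV)"
    by (subst nn_integral_count_space_swap) (auto simp: nn_integral_cmult nn_integral_trans_prob_eq_1)
  have \<eta>P: "(\<integral>\<^sup>+ y. \<eta> y * trans_prob 1 y x \<partial>count_space UNIV) = \<eta> x" for x
  proof (rule nn_integral_count_space_eq_pointwise[where g = \<eta>])
    fix x
    have "(\<integral>\<^sup>+ y. \<eta> y * trans_prob 1 y x \<partial>count_space UNIV) \<le> (\<integral>\<^sup>+ y. nu y * trans_prob 1 y x \<partial>count_space UNIV)"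
      by (intro nn_integral_mono mult_right_mono) (auto simp: \<eta>_def)
    moreover have "(\<integral>\<^sup>+ y. \<eta> y * trans_prob 1 y x \<partial>count_space UNIV) \<le> (\<integral>\<^sup>+ y. wt y * trans_prob 1 y x \<partial>count_space UNIV)"
      by (intro nn_integral_mono mult_right_mono) (auto simp: \<eta>_def)
    ultimately show "(\<integral>\<^sup>+ y. \<eta> y * trans_prob 1 y x \<partial>count_space UNIV) \<le> \<eta> x"
      unfolding nuP piP by (simp add: \<eta>_def)
  qed (use mass fin in auto)
  \<comment> \<open>Equality at \<open>x\<close> leaves no slack in the sum over the predecessors of
    \<open>x\<close>, so it passes to each \<open>y\<close> from which \<open>x\<close> is reached
    in unit time with positive probability.\<close>
  have pred: "\<eta> y = wt y" if x: "\<eta> x = wt x" and "x \<noteq> y" "0 < Q y x" for x y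
  proof -
    have "\<eta> y * trans_prob 1 y x = wt y * trans_prob 1 y x"
    proof (rule nn_integral_count_space_eq_pointwise[where g = "\<lambda>y. wt y * trans_prob 1 y x"])
      show "\<eta> y * trans_prob 1 y x \<le> wt y * trans_prob 1 y x" for y
        by (intro mult_right_mono) (auto simp: \<eta>_def)
    qed (simp_all add: \<eta>P piP x)
    moreover have "0 < trans_prob 1 y x" using that by (intro trans_prob_pos) auto
    moreover have "trans_prob 1 y x < \<top>"
      unfolding trans_prob_def using prob_space.emeasure_le_1[OF prob_space_start_at, of Q y]
      by (meson ennreal_one_less_top le_less_trans)
    ultimately show ?thesis 
      using ennreal_mult_cancel_left[of "trans_prob 1 y x" "\<eta> y" "wt y"]
      by (auto simp: mult.commute[of "trans_prob 1 y x"])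
  qed
  \<comment> \<open>If there were no such state, \<open>nu\<close> would lie strictly below
    \<open>wt\<close> everywhere although both have mass 1.\<close>
  obtain x0 where x0: "\<eta> x0 = wt x0"
  proof (cases "\<exists>x. wt x \<le> nu x")
    case True
    then obtain x where "wt x \<le> nu x" by blast
    then show ?thesis by (intro that[of x]) (simp add: \<eta>_def min.absorb2)
  next
    case False
    then have "nu x = wt x" for x
      by (intro nn_integral_count_space_eq_pointwise) (auto simp: nu1 nn_integral_wt not_le less_imp_le)
    then show ?thesis using False by (metis order_refl)
  qed
  have all: "\<eta> y = wt y" for y
    using irreducible[of y x0]
  proof (induction rule: converse_rtrancl_induct)
    case base
    show ?case by (rule x0)
  next
    case (step y z)
    then show ?case using pred[of z y] by auto
  qed
  have "wt x = nu x" for x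
  proof (rule nn_integral_count_space_eq_pointwise[where f = "\<lambda>x. wt x" and g = nu])
    show "wt x \<le> nu x" for x using all[of x] unfolding \<eta>_def by (metis min.cobounded1)
  qed (simp_all add: nu1 nn_integral_wt)
  then show ?thesis by (intro pmf_eqI) (simp add: nu_def)
qed

end

section \<open>Time reversal and positive recurrence\<close>

context reversible_ctmc
begin

text \<open>Absolute observation times rebased at \<open>s\<close>, the form that the Markov
  property consumes. Observed values are genuine states here; \<open>None\<close> is treated
  separately.\<close>

definition times_from :: "real \<Rightarrow> (real \<times> 's) list \<Rightarrow> (real \<times> 's option) list" where
  "times_from s M = map (\<lambda>p. (fst p - s, Some (snd p))) M"

primrec path_weight :: "real \<Rightarrow> 's \<Rightarrow> (real \<times> 's) list \<Rightarrow> ennreal" where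
  "path_weight s x [] = 1"
| "path_weight s x (p # M) = trans_prob (fst p - s) x (snd p) * path_weight (fst p) (snd p) M"

lemma holds_after_times_from:
  "holds_after r (times_from s M) w \<longleftrightarrow> (\<forall>p\<in>set M. chain Q (r + (fst p - s)) w = Some (snd p))"
  by (simp add: holds_after_def times_from_def)

lemma pred_holds_after' [measurable]: "Measurable.pred noise_algebra (holds_after s L)"
  using pred_holds_after[of "\<lambda>_. s" noise_algebra "\<lambda>w. w" L] by simp

lemma pred_chain' [measurable]: "Measurable.pred noise_algebra (\<lambda>w. chain Q t w = y)"
  by measurable

text \<open>The Markov property at each observation in turn; the sorted times make all increments
  nonnegative.\<close>

lemma emeasure_path_weight:
  "sorted_wrt (\<le>) (s # map fst M) \<Longrightarrow>
    emeasure (start_at Q x) {w. holds_after 0 (times_from s M) w} = path_weight s x M"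
proof (induction M arbitrary: s x)
  case Nil
  then show ?case by (simp add: times_from_def)
next
  case (Cons p M)
  obtain t y where p: "p = (t, y)" by (cases p)
  have "{w. holds_after 0 (times_from s (p # M)) w} =
     {w. chain Q (t - s) w = Some y \<and> holds_after (t - s) (times_from t M) w}"
    by (auto simp: holds_after_times_from p)
  then have "emeasure (start_at Q x) {w. holds_after 0 (times_from s (p # M)) w} =
     trans_prob (t - s) x y * emeasure (start_at Q y) {w. holds_after 0 (times_from t M) w}"
    using Cons.prems by (simp only:, intro markov_property) (auto simp: p times_from_def)
  also have "\<dots> = trans_prob (t - s) x y * path_weight t y M"
    using Cons.prems by (subst Cons.IH) (auto simp: p)
  finally show ?case by (simp add: p)
qed

lemma emeasure_finite_dim:
  assumes "sorted_wrt (\<le>) (s # map fst M)" and s: "0 \<le> s"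
  shows "emeasure (chain_space Q \<pi>) {w. holds_after 0 (times_from 0 ((s, x) # M)) w} = wt x * path_weight s x M"
proof -
  have eq: "{w. holds_after 0 (times_from 0 ((s, x) # M)) w} = {w. chain Q s w = Some x \<and> holds_after s (times_from s M) w}"
    by (auto simp: holds_after_times_from)
  have "emeasure (chain_space Q \<pi>) {w. holds_after 0 (times_from 0 ((s, x) # M)) w} =
    (\<integral>\<^sup>+ z. wt z * (trans_prob s z x * emeasure (start_at Q x) {w. holds_after 0 (times_from s M) w}) \<partial>count_space UNIV)"
    unfolding eq using assms
    by (subst emeasure_chain_space, measurable, subst markov_property) (auto simp: times_from_def)
  also have "\<dots> = (\<integral>\<^sup>+ z. wt z * trans_prob s z x \<partial>count_space UNIV) * path_weight s x M"
    by (simp add: emeasure_path_weight[OF assms(1)] mult.assoc[symmetric] nn_integral_multc)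
  also have "(\<integral>\<^sup>+ z. wt z * trans_prob s z x \<partial>count_space UNIV) = wt x"
    using stationary_\<pi> s by (simp add: stationary_iff)
  finally show ?thesis .
qed

definition reflect :: "real \<Rightarrow> (real \<times> 'b) list \<Rightarrow> (real \<times> 'b) list" where
  "reflect T M = map (\<lambda>p. (T - fst p, snd p)) M"

text \<open>
  Moving the marked point \<open>(s, x)\<close> through a list of observations, forwards in time to its right and
  backwards to its left, leaves the product of weights unchanged.
\<close>

lemma path_weight_reflect:
  assumes "sorted_wrt (\<le>) (s # map fst M)" and "rev M @ (s, x) # A = (s', x') # A'"
  shows "wt x * path_weight s x M * path_weight (T - s) x (reflect T A) = wt x' * path_weight (T - s') x' (reflect T A')"
  using assms
proof (induction M arbitrary: s x A)
  case Nil
  then show ?case by simp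
next
  case (Cons p M)
  obtain t y where p: "p = (t, y)" by (cases p)
  have "0 \<le> t - s" using Cons.prems by (simp add: p)
  note sym = trans_prob_sym[OF this, of x y]
  have "wt x * path_weight s x (p # M) * path_weight (T - s) x (reflect T A) =
     (wt x * trans_prob (t - s) x y) * path_weight t y M * path_weight (T - s) x (reflect T A)"
    by (simp add: p mult_ac)
  \<comment> \<open>Symmetry trades the forward step from \<open>x\<close> to \<open>y\<close> for a
    step from \<open>y\<close> to \<open>x\<close>, which becomes the head of the reflected
    list.\<close>
  also have "\<dots> = wt y * path_weight t y M * path_weight (T - t) y (reflect T ((s, x) # A))"
    unfolding sym by (simp add: reflect_def mult_ac)
  also have "\<dots> = wt x' * path_weight (T - s') x' (reflect T A')"
    using Cons.prems by (intro Cons.IH) (auto simp: p)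
  finally show ?case .
qed

text \<open>The marked point is carried from the first observation to the last, after which the same
  product reads as a path of the reflected times, now in increasing order.\<close>

lemma emeasure_holds_after_reflect_sorted:
  assumes "sorted (map fst M)" and "fst ` set M \<subseteq> {0..T}"
  shows "emeasure (chain_space Q \<pi>) {w. holds_after 0 (times_from 0 M) w} =
    emeasure (chain_space Q \<pi>) {w. holds_after 0 (times_from 0 (reflect T M)) w}"
proof (cases M)
  case Nil
  then show ?thesis by (simp add: reflect_def)
next
  case (Cons p M1)
  obtain s x where p: "p = (s, x)" by (cases p)
  obtain s' x' A' where rev: "rev M = (s', x') # A'" using Cons by (cases "rev M") auto
  have M': "set M = set ((s', x') # A')" using rev by (metis set_rev)
  have sorted': "sorted_wrt (\<le>) (map (\<lambda>p. T - fst p) (rev M))"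
    using assms(1) by (simp add: rev_map[symmetric] sorted_wrt_map sorted_wrt_rev)
  have "emeasure (chain_space Q \<pi>) {w. holds_after 0 (times_from 0 M) w} = wt x * path_weight s x M1"
    unfolding Cons p using assms by (intro emeasure_finite_dim) (auto simp: Cons p)
  also have "\<dots> = wt x' * path_weight (T - s') x' (reflect T A')"
    using path_weight_reflect[of s M1 x "[]" s' x' A' T] assms rev by (simp add: Cons p reflect_def)
  also have "\<dots> = emeasure (chain_space Q \<pi>) {w. holds_after 0 (times_from 0 ((T - s', x') # reflect T A')) w}"
    using sorted' assms(2) M' by (intro emeasure_finite_dim[symmetric]) (auto simp: rev reflect_def comp_def)
  \<comment> \<open>The event depends only on the set of observations, so the order of the list is
    immaterial here.\<close>
  also have "{w. holds_after 0 (times_from 0 ((T - s', x') # reflect T A')) w} =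
     {w. holds_after 0 (times_from 0 (reflect T M)) w}"
    using M' by (auto simp: holds_after_times_from reflect_def)
  finally show ?thesis .
qed

lemma emeasure_holds_after_None:
  assumes "(t, None) \<in> set L" and t: "0 \<le> t"
  shows "emeasure (chain_space Q \<pi>) {w. holds_after 0 L w} = 0"
proof -
  have m: "{w. chain Q t w = None} \<in> sets noise_algebra"
    using pred_chain'[of t None] by (simp add: pred_def)
  have "emeasure (start_at Q x) {w. holds_after 0 L w} = 0" for x
  proof -
    have "emeasure (start_at Q x) {w. holds_after 0 L w} \<le> emeasure (start_at Q x) {w. chain Q t w = None}"
      using assms m by (intro emeasure_mono) (auto simp: holds_after_def)
    then show ?thesis using emeasure_chain_None[OF t] by simp
  qed
  then show ?thesis by (subst emeasure_chain_space) auto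
qed

lemma emeasure_holds_after_reflect:
  assumes T: "fst ` set L \<subseteq> {0..T}"
  shows "emeasure (chain_space Q \<pi>) {w. holds_after 0 L w} =
    emeasure (chain_space Q \<pi>) {w. holds_after 0 (reflect T L) w}"
proof (cases "\<exists>t. (t, None) \<in> set L")
  case True
  then obtain t where t: "(t, None) \<in> set L" by blast
  moreover from t T have "0 \<le> t" "t \<le> T" by force+
  moreover from t have "(T - t, None) \<in> set (reflect T L)" by (force simp: reflect_def)
  ultimately show ?thesis by (simp add: emeasure_holds_after_None[of t] emeasure_holds_after_None[of "T - t"])
next
  case False
  \<comment> \<open>No value is \<open>None\<close> in this case, so \<open>the\<close> loses
    nothing. Sorting is needed because \<open>reversible\<close> allows the times in any order and
    with repetitions.\<close>
  define M where "M = sort_key fst (map (\<lambda>p. (fst p, the (snd p))) L)"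
  have set_M: "set M = (\<lambda>p. (fst p, the (snd p))) ` set L" by (simp add: M_def)
  have some: "Some (the (snd p)) = snd p" if "p \<in> set L" for p
    using False that by (cases p; cases "snd p") auto
  have "holds_after 0 L w \<longleftrightarrow> holds_after 0 (times_from 0 M) w" for w
    unfolding holds_after_times_from unfolding holds_after_def by (simp add: set_M some cong: ball_cong)
  moreover have "holds_after 0 (reflect T L) w \<longleftrightarrow> holds_after 0 (times_from 0 (reflect T M)) w" for w
    unfolding holds_after_times_from unfolding holds_after_def reflect_def
    by (simp add: set_M some cong: ball_cong)
  moreover have "fst ` set M \<subseteq> {0..T}" using T by (auto simp: set_M)
  ultimately show ?thesis by (simp add: emeasure_holds_after_reflect_sorted M_def)
qed

lemma reversible_\<pi>: "reversible Q \<pi>"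
  unfolding reversible_def
proof (intro allI impI)
  fix T :: real and ts and xs :: "'s option list"
  assume *: "set ts \<subseteq> {0..T} \<and> length xs = length ts"
  let ?L = "zip ts xs"
  have "(\<forall>i<length ts. chain Q (ts ! i) w = xs ! i) \<longleftrightarrow> holds_after 0 ?L w" for w
    using * by (auto simp: holds_after_def set_zip)
  moreover have "(\<forall>i<length ts. chain Q (T - ts ! i) w = xs ! i) \<longleftrightarrow> holds_after 0 (reflect T ?L) w" for w
    using * by (auto simp: holds_after_def reflect_def set_zip)
  moreover have "fst ` set ?L \<subseteq> {0..T}" using * by (auto dest: set_zip_leftD)
  ultimately show "measure (chain_space Q \<pi>) {w \<in> space (chain_space Q \<pi>). \<forall>i<length ts. chain Q (ts ! i) w = xs ! i} =
     measure (chain_space Q \<pi>) {w \<in> space (chain_space Q \<pi>). \<forall>i<length ts. chain Q (T - ts ! i) w = xs ! i}"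
    by (simp add: measure_def emeasure_holds_after_reflect)
qed

section \<open>Mean return times\<close>

definition avoids :: "'s \<Rightarrow> nat \<Rightarrow> 's noise \<Rightarrow> bool" where
  "avoids x k w \<longleftrightarrow> (\<forall>i\<in>{1..k}. jump_chain i w \<noteq> x)"

lemma pred_avoids [measurable]: "Measurable.pred noise_algebra (avoids x k)"
  unfolding avoids_def by measurable

text \<open>The return time is cut into the holding times before the first entrance into
  \<open>x\<close>. Since \<open>avoids\<close> starts at step 1, the initial visit to
  \<open>x\<close> is not a return and its holding time is counted.\<close>

definition time_before :: "'s \<Rightarrow> nat \<Rightarrow> 's noise \<Rightarrow> ennreal" where
  "time_before x k w = (if avoids x k w then holding_time Q k w else 0)"

lemma measurable_time_before [measurable]: "time_before x k \<in> borel_measurable noise_algebra"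
  unfolding time_before_def by measurable

lemma avoids_Suc: "avoids x (Suc k) w \<longleftrightarrow> fst (advance w) \<noteq> x \<and> avoids x k (advance w)"
proof -
  have range: "{1..Suc k} = Suc ` insert 0 {1..k}"
    by (auto simp: image_iff)
  have "(\<forall>i\<in>{1..Suc k}. P i) \<longleftrightarrow> P (Suc 0) \<and> (\<forall>i\<in>{1..k}. P (Suc i))" for P
    unfolding range by blast
  then show ?thesis unfolding avoids_def by (simp only: jump_chain_Suc_advance jump_chain.simps(1))
qed

lemma time_before_Suc: "time_before x (Suc k) w = (if fst (advance w) = x then 0 else time_before x k (advance w))"
  by (simp add: time_before_def avoids_Suc holding_time_Suc_advance)

lemma nn_integral_exp: "(\<integral>\<^sup>+ h. indicator {0..} h * (ennreal (exp (- q x * h)) * ennreal (q x)) \<partial>lborel) = 1"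
  using nn_integral_first_jump[of "\<lambda>_. 1" "\<lambda>_. 1" x] by (simp add: nn_integral_K)

lemma nn_integral_time_before_0: "ennreal (q y) * (\<integral>\<^sup>+ w. time_before x 0 w \<partial>start_at Q y) = 1"
proof -
  have "(\<integral>\<^sup>+ w. time_before x 0 w \<partial>start_at Q y) =
     (\<integral>\<^sup>+ h. indicator {0..} h * (ennreal (exp (- q y * h)) *
        (\<integral>\<^sup>+ z. K y z * (\<integral>\<^sup>+ w. ennreal h \<partial>start_at Q z) \<partial>count_space UNIV)) \<partial>lborel)"
    using nn_integral_first_jump[of "\<lambda>p. ennreal (fst p)" "time_before x 0" y]
    by (simp add: time_before_def avoids_def holding_time_0)
  also have "\<dots> = (\<integral>\<^sup>+ h. indicator {0..} h * (ennreal (exp (- q y * h)) * (ennreal (q y) * ennreal h)) \<partial>lborel)"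
    by (simp add: nn_integral_multc nn_integral_K)
  \<comment> \<open>The Erlang density of shape 0 is the exponential density, and its first moment
    is the mean holding time \<open>1 / q y\<close>.\<close>
  also have "\<dots> = (\<integral>\<^sup>+ h. ennreal (erlang_density 0 (q y) h * h ^ 1) \<partial>lborel)"
  proof (intro nn_integral_cong)
    have "ennreal (exp (- b * h)) * (ennreal b * ennreal h) = ennreal (b * exp (- b * h) * h)"
      if "0 < b" "0 \<le> h" for b h :: real
      using that by (simp add: ennreal_mult[symmetric] mult_ac)
    from this[OF q_pos[of y]] show "indicator {0..} h * (ennreal (exp (- q y * h)) * (ennreal (q y) * ennreal h)) =
       ennreal (erlang_density 0 (q y) h * h ^ 1)" for h
      by (auto simp: erlang_density_def mult_ac split: split_indicator)
  qed
  also have "\<dots> = ennreal (1 / q y)"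
    by (subst nn_integral_erlang_ith_moment[OF q_pos]) simp
  finally show ?thesis using q_pos[of y] by (simp add: ennreal_mult'[symmetric])
qed

text \<open>The later holding times do not depend on the first one, whose density integrates to 1,
  so only the jump law remains. A jump into \<open>x\<close> ends the excursion, whence the default
  0 there.\<close>

lemma nn_integral_time_before_Suc:
  "ennreal (q y) * (\<integral>\<^sup>+ w. time_before x (Suc k) w \<partial>start_at Q y) =
    (\<integral>\<^sup>+ z. K y z * (if z = x then 0 else \<integral>\<^sup>+ w. time_before x k w \<partial>start_at Q z) \<partial>count_space UNIV)"
proof -
  define a where "a z = (if z = x then 0 else \<integral>\<^sup>+ w. time_before x k w \<partial>start_at Q z)" for z
  define c where "c = (\<integral>\<^sup>+ z. K y z * a z \<partial>count_space UNIV)"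
  have a: "(\<integral>\<^sup>+ w. (if fst w = x then 0 else time_before x k w) \<partial>start_at Q z) = a z" for z
  proof -
    have "(\<integral>\<^sup>+ w. (if fst w = x then 0 else time_before x k w) \<partial>start_at Q z) =
      (\<integral>\<^sup>+ w. (if z = x then 0 else time_before x k w) \<partial>start_at Q z)"
      using AE_start_at_fst[where Q = Q and x = z] by (intro nn_integral_cong_AE) (auto elim!: eventually_mono)
    then show ?thesis by (simp add: a_def)
  qed
  have "(\<integral>\<^sup>+ w. time_before x (Suc k) w \<partial>start_at Q y) = (\<integral>\<^sup>+ h. indicator {0..} h * (ennreal (exp (- q y * h)) *
    (\<integral>\<^sup>+ z. K y z * a z \<partial>count_space UNIV)) \<partial>lborel)"
  proof (subst nn_integral_first_jump[where F = "\<lambda>p. if fst (snd p) = x then 0 else time_before x k (snd p)"])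
    have [measurable]: "Measurable.pred noise_algebra (\<lambda>w :: 's noise. fst w = x)"
      using pred_jump_chain[of "\<lambda>w. w" noise_algebra 0 x] by simp
    have "(\<lambda>w. if fst w = x then 0 else time_before x k w) \<in> borel_measurable noise_algebra"
      by measurable
    then show "(\<lambda>p. if fst (snd p) = x then 0 else time_before x k (snd p)) \<in> borel_measurable (borel \<Otimes>\<^sub>M noise_algebra)"
      by (rule measurable_compose[OF measurable_snd])
  qed (simp_all only: time_before_Suc a fst_conv snd_conv measurable_time_before)
  then have eq: "(\<integral>\<^sup>+ w. time_before x (Suc k) w \<partial>start_at Q y) = (\<integral>\<^sup>+ h. indicator {0..} h * (ennreal (exp (- q y * h)) * c) \<partial>lborel)"
    by (simp add: c_def)
  have "ennreal (q y) * (\<integral>\<^sup>+ w. time_before x (Suc k) w \<partial>start_at Q y) =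
    (\<integral>\<^sup>+ h. ennreal (q y) * (indicator {0..} h * (ennreal (exp (- q y * h)) * c)) \<partial>lborel)"
    unfolding eq by (rule nn_integral_cmult[symmetric]) measurable
  also have "\<dots> = (\<integral>\<^sup>+ h. (indicator {0..} h * (ennreal (exp (- q y * h)) * ennreal (q y))) * c \<partial>lborel)"
    by (simp only: mult_ac)
  also have "\<dots> = c"
    by (subst nn_integral_multc, measurable) (simp only: nn_integral_exp mult_1_left)
  finally show ?thesis by (simp add: a_def c_def)
qed

text \<open>
  Kac's argument: the mean \<open>S k\<close> of \<open>time_before x k\<close> under the invariant weights \<open>wt y * q y\<close> of the
  jump chain telescopes, since \<open>S k - S (Suc k)\<close> is the \<open>k\<close>-th summand below, and \<open>S 0 = 1\<close>.
\<close>

lemma suminf_time_before: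
  "wt x * ennreal (q x) * (\<Sum>k. \<integral>\<^sup>+ w. time_before x k w \<partial>start_at Q x) \<le> 1"
proof -
  define a where "a k y = (\<integral>\<^sup>+ w. time_before x k w \<partial>start_at Q y)" for k y
  define S where "S k = (\<integral>\<^sup>+ y. wt y * (ennreal (q y) * a k y) \<partial>count_space UNIV)" for k
  have S0: "S 0 = 1"
    unfolding S_def a_def nn_integral_time_before_0 by (simp add: nn_integral_wt)
  have step: "S k = S (Suc k) + wt x * ennreal (q x) * a k x" for k
  proof -
    let ?b = "\<lambda>z. if z = x then 0 else a k z"
    have "S (Suc k) = (\<integral>\<^sup>+ y. \<integral>\<^sup>+ z. wt y * (K y z * ?b z) \<partial>count_space UNIV \<partial>count_space UNIV)"
      unfolding S_def a_def nn_integral_time_before_Suc by (simp add: nn_integral_cmult)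
    also have "\<dots> = (\<integral>\<^sup>+ z. \<integral>\<^sup>+ y. wt y * (K y z * ?b z) \<partial>count_space UNIV \<partial>count_space UNIV)"
      by (rule nn_integral_count_space_swap) simp
    \<comment> \<open>By detailed balance the sum over the previous state \<open>y\<close> is
      \<open>q z\<close>: this is the invariance of \<open>wt y * q y\<close> under the jump
      chain.\<close>
    also have "\<dots> = (\<integral>\<^sup>+ z. \<integral>\<^sup>+ y. (wt z * ?b z) * K z y \<partial>count_space UNIV \<partial>count_space UNIV)"
      by (intro nn_integral_cong) (simp only: mult.assoc[symmetric] balance_K[of _ z for z], simp only: mult_ac)
    also have "\<dots> = (\<integral>\<^sup>+ z. (wt z * ?b z) * ennreal (q z) \<partial>count_space UNIV)"
      by (simp add: nn_integral_cmult nn_integral_K)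
    finally have S': "S (Suc k) = (\<integral>\<^sup>+ z. (wt z * ?b z) * ennreal (q z) \<partial>count_space UNIV)" .
    have "S k = (\<integral>\<^sup>+ z. (wt z * ?b z) * ennreal (q z) + (if z = x then wt z * ennreal (q z) * a k z else 0) \<partial>count_space UNIV)"
      unfolding S_def by (intro nn_integral_cong) (auto simp: mult_ac)
    also have "\<dots> = S (Suc k) + wt x * ennreal (q x) * a k x"
      by (subst nn_integral_add) (auto simp: S' nn_integral_count_space_single)
    finally show ?thesis .
  qed
  \<comment> \<open>The telescoping sum is kept in additive form, so nothing is subtracted in
    \<open>ennreal\<close>.\<close>
  have "S n + (\<Sum>k<n. wt x * ennreal (q x) * a k x) = 1" for n
  proof (induction n)
    case (Suc n)
    then show ?case using step[of n] by (simp add: add_ac)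
  qed (simp add: S0)
  then have "(\<Sum>k<n. wt x * ennreal (q x) * a k x) \<le> 1" for n
    by (metis add.commute le_iff_add)
  then have "(\<Sum>k. wt x * ennreal (q x) * a k x) \<le> 1"
    by (intro suminf_le_const) auto
  then show ?thesis by (simp add: a_def)
qed

text \<open>Non-explosion holds simultaneously for all integer horizons, and a finite total holding
  time would lie below one of them.\<close>

lemma AE_suminf_holding_time: "AE w in start_at Q x. (\<Sum>k. holding_time Q k w) = \<infinity>"
proof -
  have "AE w in start_at Q x. \<not> (\<forall>m. jump_time Q (Suc m) w \<le> ennreal (real n))" for n
  proof (rule AE_I[of _ _ "{w. \<forall>m. jump_time Q (Suc m) w \<le> ennreal (real n)}"])
    have "Measurable.pred noise_algebra (\<lambda>w. \<forall>m. jump_time Q (Suc m) w \<le> ennreal (real n))"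
      by measurable
    then show "{w. \<forall>m. jump_time Q (Suc m) w \<le> ennreal (real n)} \<in> sets (start_at Q x)"
      by (simp add: pred_def)
    show "emeasure (start_at Q x) {w. \<forall>m. jump_time Q (Suc m) w \<le> ennreal (real n)} = 0"
      by (rule emeasure_explosion) simp
  qed auto
  then have "AE w in start_at Q x. \<forall>n. \<not> (\<forall>m. jump_time Q (Suc m) w \<le> ennreal (real n))"
    by (simp add: AE_all_countable)
  then show ?thesis
  proof eventually_elim
    case (elim w)
    show ?case
    proof (rule ccontr)
      assume "(\<Sum>k. holding_time Q k w) \<noteq> \<infinity>"
      then obtain n where n: "(\<Sum>k. holding_time Q k w) < of_nat n"
        using ennreal_Ex_less_of_nat[of "\<Sum>k. holding_time Q k w"] by (auto simp: less_top)
      have "jump_time Q (Suc m) w \<le> ennreal (real n)" for m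
      proof -
        have "jump_time Q (Suc m) w \<le> (\<Sum>k. holding_time Q k w)"
          unfolding jump_time_def by (intro sum_le_suminf) auto
        then show ?thesis using n by (simp add: ennreal_of_nat_eq_real_of_nat)
      qed
      then show False using elim by blast
    qed
  qed
qed

text \<open>If \<open>x\<close> is first entered at step \<open>m\<close>, the summands with
  \<open>k < m\<close> are exactly the holding times up to then. If it is never entered, every
  summand is a full holding time, and the assumption makes the right side infinite like the infimum
  over the empty set on the left.\<close>

lemma return_time_le:
  assumes "(\<Sum>k. holding_time Q k w) = \<infinity>"
  shows "return_time Q x w \<le> (\<Sum>k. time_before x k w)"
proof (cases "\<exists>m. 1 \<le> m \<and> jump_chain m w = x")
  case True
  define m where "m = (LEAST m. 1 \<le> m \<and> jump_chain m w = x)"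
  have m: "1 \<le> m \<and> jump_chain m w = x"
    unfolding m_def using True by (rule LeastI_ex)
  have "avoids x k w" if "k < m" for k
    unfolding avoids_def
  proof
    fix i assume "i \<in> {1..k}"
    then have "i < m" "1 \<le> i" using that by auto
    then show "jump_chain i w \<noteq> x" unfolding m_def using not_less_Least by blast
  qed
  then have "jump_time Q m w = (\<Sum>k<m. time_before x k w)"
    unfolding jump_time_def by (intro sum.cong) (auto simp: time_before_def)
  moreover have "return_time Q x w \<le> jump_time Q m w"
    unfolding return_time_def using m by (intro INF_lower) auto
  moreover have "(\<Sum>k<m. time_before x k w) \<le> (\<Sum>k. time_before x k w)"
    by (intro sum_le_suminf) auto
  ultimately show ?thesis by simp
next
  case False
  then have "time_before x k w = holding_time Q k w" for k
    by (auto simp: time_before_def avoids_def)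
  then show ?thesis using assms by simp
qed

lemma positive_recurrent: "positive_recurrent Q"
  unfolding positive_recurrent_def
proof (intro allI disjI2)
  fix x
  have "(\<integral>\<^sup>+ w. return_time Q x w \<partial>start_at Q x) \<le> (\<integral>\<^sup>+ w. (\<Sum>k. time_before x k w) \<partial>start_at Q x)"
    using AE_suminf_holding_time[of x] by (intro nn_integral_mono_AE) (auto elim!: eventually_mono intro: return_time_le)
  also have "\<dots> = (\<Sum>k. \<integral>\<^sup>+ w. time_before x k w \<partial>start_at Q x)"
    by (rule nn_integral_suminf) measurable
  also have "\<dots> < \<infinity>"
  proof -
    have "wt x * ennreal (q x) * (\<Sum>k. \<integral>\<^sup>+ w. time_before x k w \<partial>start_at Q x) < \<top>"
      using suminf_time_before[of x] by (rule le_less_trans) simp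
    moreover have "wt x * ennreal (q x) \<noteq> 0" using pmf_\<pi>_pos[of x] q_pos[of x] by auto
    ultimately show ?thesis by (auto simp: ennreal_mult_less_top less_top[symmetric])
  qed
  finally show "(\<integral>\<^sup>+ w. return_time Q x w \<partial>chain_space Q (return_pmf x)) < \<infinity>"
    by (simp add: start_at_def)
qed

end

section \<open>The network\<close>

text \<open>The ratio of the geometric law of the queue at site \<open>i\<close> while the customer
  is at \<open>j\<close>.\<close>

definition load :: "real \<Rightarrow> real \<Rightarrow> 'a::finite \<Rightarrow> 'a \<Rightarrow> real" where
  "load \<rho> \<phi> j i = (if i = j then \<rho> * exp \<phi> else \<rho>)"

text \<open>Built from a uniform location and independent geometric queues, so that normalisation
  comes for free; the two load conditions make the geometric parameters admissible.\<close>

definition network_pmf :: "real \<Rightarrow> real \<Rightarrow> 'a::finite state pmf" where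
  "network_pmf \<rho> \<phi> = bind_pmf (pmf_of_set UNIV)
     (\<lambda>j. map_pmf (Pair j) (Pi_pmf UNIV 0 (\<lambda>i. geometric_pmf (1 - load \<rho> \<phi> j i))))"

definition weight :: "real \<Rightarrow> real \<Rightarrow> 'a::finite \<Rightarrow> ('a \<Rightarrow> nat) \<Rightarrow> real" where
  "weight \<rho> \<phi> j n = \<rho> ^ (\<Sum>i\<in>UNIV. n i) * exp (\<phi> * real (n j))"

lemma prod_load_power:
  "(\<Prod>i\<in>UNIV. load \<rho> \<phi> j i ^ n i) = weight \<rho> \<phi> j n"
proof -
  have "(\<Prod>i\<in>UNIV. load \<rho> \<phi> j i ^ n i) = (\<Prod>i\<in>UNIV. \<rho> ^ n i * (if i = j then exp \<phi> ^ n i else 1))"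
    by (intro prod.cong) (auto simp: load_def power_mult_distrib)
  then show ?thesis
    by (simp add: weight_def prod.distrib power_sum exp_of_nat_mult[symmetric] mult.commute)
qed

lemma prod_one_minus_load:
  "(\<Prod>i\<in>UNIV. 1 - load \<rho> \<phi> j i) = (1 - \<rho> * exp \<phi>) * (1 - \<rho>) ^ (CARD('a) - 1)" for j :: "'a::finite"
proof -
  have "(\<Prod>i\<in>UNIV. 1 - load \<rho> \<phi> j i) = (1 - load \<rho> \<phi> j j) * (\<Prod>i\<in>UNIV - {j}. 1 - load \<rho> \<phi> j i)"
    by (rule prod.remove) auto
  also have "(\<Prod>i\<in>UNIV - {j}. 1 - load \<rho> \<phi> j i) = (\<Prod>i\<in>UNIV - {j}. 1 - \<rho>)"
    by (intro prod.cong) (auto simp: load_def)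
  finally show ?thesis by (simp add: load_def card_Diff_singleton)
qed

lemma pmf_network_pmf:
  fixes j :: "'a::finite"
  assumes "0 < \<rho>" "\<rho> < 1" "\<rho> * exp \<phi> < 1"
  shows "pmf (network_pmf \<rho> \<phi>) (j, n) =
    1 / real CARD('a) * (1 - \<rho> * exp \<phi>) * (1 - \<rho>) ^ (CARD('a) - 1) * weight \<rho> \<phi> j n"
proof -
  have load: "0 < 1 - load \<rho> \<phi> j i \<and> 1 - load \<rho> \<phi> j i \<le> 1" for i
    using assms by (auto simp: load_def)
  have "pmf (map_pmf (Pair j') p) (j, n) = (if j' = j then pmf p n else 0)" for j' and p :: "('a \<Rightarrow> nat) pmf"
    by (auto simp: pmf_map_inj' inj_def pmf_eq_0_set_pmf)
  then have "pmf (network_pmf \<rho> \<phi>) (j, n) =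
     pmf (Pi_pmf UNIV 0 (\<lambda>i. geometric_pmf (1 - load \<rho> \<phi> j i))) n / real CARD('a)"
    unfolding network_pmf_def by (subst pmf_bind_pmf_of_set) auto
  also have "pmf (Pi_pmf UNIV 0 (\<lambda>i. geometric_pmf (1 - load \<rho> \<phi> j i))) n =
      (\<Prod>i\<in>UNIV. load \<rho> \<phi> j i ^ n i * (1 - load \<rho> \<phi> j i))"
    using load by (subst pmf_Pi') auto
  also have "\<dots> = weight \<rho> \<phi> j n * ((1 - \<rho> * exp \<phi>) * (1 - \<rho>) ^ (CARD('a) - 1))"
    by (simp only: prod.distrib prod_load_power prod_one_minus_load)
  finally show ?thesis by simp
qed

section \<open>Elementary task changes, their inverses and their effect on the weights\<close>

lemma sum_add_task: "(\<Sum>i\<in>UNIV. add_task k n i) = Suc (\<Sum>i\<in>UNIV. n i)" for k :: "'a::finite"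
  by (simp add: sum.remove[of UNIV k] add_task_def)

lemma add_remove_task: "1 \<le> n k \<Longrightarrow> add_task k (remove_task k n) = n"
  by (auto simp: add_task_def remove_task_def)

lemma remove_add_task: "remove_task k (add_task k n) = n"
  by (auto simp: add_task_def remove_task_def)

lemma weight_add_task: "weight \<rho> \<phi> j (add_task k n) = weight \<rho> \<phi> j n * (\<rho> * exp (\<phi> * of_bool (j = k)))"
proof -
  have "real (add_task k n j) = real (n j) + of_bool (j = k)" by (auto simp: add_task_def)
  then show ?thesis by (simp add: weight_def sum_add_task ring_distribs exp_add mult_ac)
qed

text \<open>Both weights are compared with that of the configuration without the moved task. A
  factor \<open>exp \<phi>\<close> appears only if the source or the destination is the loaded
  site.\<close>

lemma weight_move_task:
  assumes "1 \<le> n k"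
  shows "weight \<rho> \<phi> j (add_task l (remove_task k n)) * exp (\<phi> * of_bool (j = k)) = weight \<rho> \<phi> j n * exp (\<phi> * of_bool (j = l))"
proof -
  have "weight \<rho> \<phi> j n = weight \<rho> \<phi> j (remove_task k n) * (\<rho> * exp (\<phi> * of_bool (j = k)))"
    using weight_add_task[of \<rho> \<phi> j k "remove_task k n"] by (simp add: add_remove_task[of n k, OF assms])
  then show ?thesis by (simp add: weight_add_task mult_ac)
qed

lemma eq_add_task_iff: "n' = add_task k n \<longleftrightarrow> 1 \<le> n' k \<and> n = remove_task k n'"
proof
  assume "n' = add_task k n"
  then show "1 \<le> n' k \<and> n = remove_task k n'" by (simp add: remove_add_task) (simp add: add_task_def)
next
  assume "1 \<le> n' k \<and> n = remove_task k n'"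
  then show "n' = add_task k n" by (simp add: add_remove_task)
qed

text \<open>Both sides say that the two guards hold and that the intermediate configurations
  \<open>remove_task k n\<close> and \<open>remove_task l n'\<close> agree. The guards keep the
  truncated subtraction invertible.\<close>

lemma eq_move_task_iff:
  "1 \<le> n k \<and> n' = add_task l (remove_task k n) \<longleftrightarrow> 1 \<le> n' l \<and> n = add_task k (remove_task l n')"
  using eq_add_task_iff[of n' l "remove_task k n"] eq_add_task_iff[of n k "remove_task l n'"] by metis

text \<open>A nonzero entry of a power contains a nonzero product of entries along a path. Only
  reachability is extracted, so the length \<open>u\<close> is forgotten.\<close>

lemma mat_power_path:
  fixes A :: "real^'a^'a::finite"
  assumes A: "admissible_matrix A"
  shows "mat_power A u $ i $ k \<noteq> 0 \<Longrightarrow> (i, k) \<in> {(i, k). 0 < A $ i $ k}\<^sup>*"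
proof (induction u arbitrary: i)
  case 0
  then show ?case by (cases "i = k") (simp_all add: mat_def)
next
  case (Suc u)
  then have "(\<Sum>l\<in>UNIV. A $ i $ l * mat_power A u $ l $ k) \<noteq> 0"
    by (simp add: matrix_matrix_mult_def)
  then obtain l where "A $ i $ l * mat_power A u $ l $ k \<noteq> 0"
    by (rule sum.not_neutral_contains_not_neutral)
  moreover have "0 \<le> A $ i $ l" using A by (simp add: admissible_matrix_def)
  ultimately have "0 < A $ i $ l" "mat_power A u $ l $ k \<noteq> 0" by auto
  then show ?case using Suc.IH by (auto intro: converse_rtrancl_into_rtrancl)
qed

section \<open>Detailed balance for the network rates\<close>

locale network =
  fixes lam mu \<phi> :: real and B \<Theta> T :: "real^'a^'a::finite"
  assumes lam_pos: "0 < lam" and mu_pos: "0 < mu"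
    and admissible_B: "admissible_matrix B" and admissible_\<Theta>: "admissible_matrix \<Theta>"
    and admissible_T: "admissible_matrix T"
    and T_irreducible: "\<exists>u. positive_matrix (mat_power T u)"
    and lam_mu: "lam / mu < 1" and lam_exp_mu: "lam / mu * exp \<phi> < 1"
begin

abbreviation rate :: "'a state \<Rightarrow> 'a state \<Rightarrow> real" where
  "rate \<equiv> jump_rate lam mu \<phi> B \<Theta> T"

abbreviation R :: "'a state \<Rightarrow> 'a state \<Rightarrow> real" where
  "R \<equiv> generator lam mu \<phi> B \<Theta> T"

abbreviation \<rho> :: real where "\<rho> \<equiv> lam / mu"

abbreviation W :: "'a \<Rightarrow> ('a \<Rightarrow> nat) \<Rightarrow> real" where "W \<equiv> weight \<rho> \<phi>"

definition arrivals :: "'a \<Rightarrow> ('a \<Rightarrow> nat) \<Rightarrow> ('a \<Rightarrow> nat) \<Rightarrow> real" where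
  "arrivals j n n' = (\<Sum>k\<in>UNIV. if n' = add_task k n then lam * exp (\<phi> * of_bool (j = k)) else 0)"

definition departures :: "'a \<Rightarrow> ('a \<Rightarrow> nat) \<Rightarrow> ('a \<Rightarrow> nat) \<Rightarrow> real" where
  "departures j n n' = (\<Sum>k\<in>UNIV. if 1 \<le> n k \<and> n' = remove_task k n then mu else 0)"

definition moves :: "'a \<Rightarrow> ('a \<Rightarrow> nat) \<Rightarrow> ('a \<Rightarrow> nat) \<Rightarrow> real" where
  "moves j n n' = (\<Sum>k\<in>UNIV. \<Sum>l\<in>UNIV.
     if k \<noteq> l \<and> k \<noteq> j \<and> l \<noteq> j \<and> 1 \<le> n k \<and> n' = add_task l (remove_task k n) then B $ k $ l else 0)"

definition moves_out :: "'a \<Rightarrow> ('a \<Rightarrow> nat) \<Rightarrow> ('a \<Rightarrow> nat) \<Rightarrow> real" where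
  "moves_out j n n' = (\<Sum>l\<in>UNIV.
     if l \<noteq> j \<and> 1 \<le> n j \<and> n' = add_task l (remove_task j n) then \<Theta> $ j $ l else 0)"

definition moves_in :: "'a \<Rightarrow> ('a \<Rightarrow> nat) \<Rightarrow> ('a \<Rightarrow> nat) \<Rightarrow> real" where
  "moves_in j n n' = (\<Sum>k\<in>UNIV.
     if k \<noteq> j \<and> 1 \<le> n k \<and> n' = add_task j (remove_task k n) then \<Theta> $ k $ j * exp \<phi> else 0)"

lemma rate_eq: "rate (j, n) (j', n') =
  (if j' = j then arrivals j n n' + departures j n n' + moves j n n' + moves_out j n n' + moves_in j n n'
   else if n' = n then exp (- \<phi> * real (n j)) * T $ j $ j' else 0)"
  unfolding jump_rate_def prod.case arrivals_def departures_def moves_def moves_out_def moves_in_def by (rule refl)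

lemma entries_nonneg: "0 \<le> B $ i $ k" "0 \<le> \<Theta> $ i $ k" "0 \<le> T $ i $ k"
  using admissible_B admissible_\<Theta> admissible_T by (simp_all add: admissible_matrix_def)

lemma symmetric: "B $ i $ k = B $ k $ i" "\<Theta> $ i $ k = \<Theta> $ k $ i" "T $ i $ k = T $ k $ i"
proof -
  have *: "A $ i $ k = A $ k $ i" if "admissible_matrix A" for A :: "real^'a^'a"
  proof -
    have "A = transpose A" using that by (simp add: admissible_matrix_def)
    then have "A $ i $ k = transpose A $ i $ k" by (rule arg_cong)
    then show ?thesis by (simp add: transpose_def)
  qed
  show "B $ i $ k = B $ k $ i" by (rule *[OF admissible_B])
  show "\<Theta> $ i $ k = \<Theta> $ k $ i" by (rule *[OF admissible_\<Theta>])
  show "T $ i $ k = T $ k $ i" by (rule *[OF admissible_T])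
qed

lemma parts_nonneg: "0 \<le> arrivals j n n'" "0 \<le> departures j n n'" "0 \<le> moves j n n'"
  "0 \<le> moves_out j n n'" "0 \<le> moves_in j n n'"
  using lam_pos mu_pos
  by (auto simp: arrivals_def departures_def moves_def moves_out_def moves_in_def entries_nonneg intro!: sum_nonneg)

lemma rate_nonneg: "0 \<le> rate x y"
  by (cases x; cases y) (auto simp: rate_eq entries_nonneg intro!: add_nonneg_nonneg parts_nonneg)

text \<open>Arrivals at \<open>k\<close> are matched term by term with departures from
  \<open>k\<close>: a further task multiplies the weight by \<open>lam / mu\<close>, and by
  \<open>exp \<phi>\<close> at the loaded site, just as the arrival rate is modified there.\<close>

lemma arrivals_departures: "W j n * arrivals j n n' = W j n' * departures j n' n"
  unfolding arrivals_def departures_def sum_distrib_left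
proof (intro sum.cong refl)
  fix k
  show "W j n * (if n' = add_task k n then lam * exp (\<phi> * of_bool (j = k)) else 0) =
      W j n' * (if 1 \<le> n' k \<and> n = remove_task k n' then mu else 0)"
  proof (cases "n' = add_task k n")
    case True
    moreover from True have "1 \<le> n' k \<and> n = remove_task k n'" by (simp only: eq_add_task_iff)
    moreover have "W j (add_task k n) * mu = W j n * (lam * exp (\<phi> * of_bool (j = k)))"
      using mu_pos by (simp add: weight_add_task)
    ultimately show ?thesis by simp
  next
    case False
    then have "\<not> (1 \<le> n' k \<and> n = remove_task k n')" by (simp only: eq_add_task_iff not_False_eq_True)
    then show ?thesis using False by auto
  qed
qed

text \<open>Neither site is loaded, so the weight is unchanged and symmetry of \<open>B\<close>
  suffices, once the two summation indices are exchanged.\<close>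

lemma moves_moves: "W j n * moves j n n' = W j n' * moves j n' n"
proof -
  have "W j n * moves j n n' = (\<Sum>k\<in>UNIV. \<Sum>l\<in>UNIV. W j n *
     (if k \<noteq> l \<and> k \<noteq> j \<and> l \<noteq> j \<and> 1 \<le> n k \<and> n' = add_task l (remove_task k n) then B $ k $ l else 0))"
    by (simp add: moves_def sum_distrib_left)
  also have "\<dots> = (\<Sum>k\<in>UNIV. \<Sum>l\<in>UNIV. W j n' *
     (if l \<noteq> k \<and> l \<noteq> j \<and> k \<noteq> j \<and> 1 \<le> n' l \<and> n = add_task k (remove_task l n') then B $ l $ k else 0))"
  proof (intro sum.cong refl)
    fix k l
    show "W j n * (if k \<noteq> l \<and> k \<noteq> j \<and> l \<noteq> j \<and> 1 \<le> n k \<and> n' = add_task l (remove_task k n) then B $ k $ l else 0) =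
      W j n' * (if l \<noteq> k \<and> l \<noteq> j \<and> k \<noteq> j \<and> 1 \<le> n' l \<and> n = add_task k (remove_task l n') then B $ l $ k else 0)"
    proof (cases "k \<noteq> l \<and> k \<noteq> j \<and> l \<noteq> j \<and> 1 \<le> n k \<and> n' = add_task l (remove_task k n)")
      case True
      then have "W j n' = W j n" using weight_move_task[of n k \<rho> \<phi> j l] by auto
      then show ?thesis using True eq_move_task_iff[of n k n' l] symmetric(1)[of k l] by auto
    next
      case False
      then show ?thesis using eq_move_task_iff[of n k n' l] by auto
    qed
  qed
  also have "\<dots> = W j n' * moves j n' n"
    unfolding moves_def sum_distrib_left by (rule sum.swap)
  finally show ?thesis .
qed

text \<open>The factor \<open>exp \<phi>\<close> in the rate into the loaded site compensates for
  the factor that the weight loses when a task leaves it.\<close>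

lemma moves_out_in: "W j n * moves_out j n n' = W j n' * moves_in j n' n"
  unfolding moves_out_def moves_in_def sum_distrib_left
proof (intro sum.cong refl)
  fix l
  show "W j n * (if l \<noteq> j \<and> 1 \<le> n j \<and> n' = add_task l (remove_task j n) then \<Theta> $ j $ l else 0) =
    W j n' * (if l \<noteq> j \<and> 1 \<le> n' l \<and> n = add_task j (remove_task l n') then \<Theta> $ l $ j * exp \<phi> else 0)"
  proof (cases "l \<noteq> j \<and> 1 \<le> n j \<and> n' = add_task l (remove_task j n)")
    case True
    then have "W j n' * exp \<phi> = W j n" using weight_move_task[of n j \<rho> \<phi> j l] by auto
    then show ?thesis using True eq_move_task_iff[of n j n' l] symmetric(2)[of j l] by auto
  next
    case False
    then show ?thesis using eq_move_task_iff[of n j n' l] by auto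
  qed
qed

lemma weight_balance: "W j n * rate (j, n) (j', n') = W j' n' * rate (j', n') (j, n)"
proof (cases "j' = j")
  case True
  have "W j n * rate (j, n) (j, n') = W j n * arrivals j n n' + W j n * departures j n n' + W j n * moves j n n'
      + W j n * moves_out j n n' + W j n * moves_in j n n'"
    by (simp add: rate_eq ring_distribs)
  also have "\<dots> = W j n' * departures j n' n + W j n' * arrivals j n' n + W j n' * moves j n' n
      + W j n' * moves_in j n' n + W j n' * moves_out j n' n"
    by (simp only: arrivals_departures[of j n n'] arrivals_departures[of j n' n, symmetric] moves_moves[of j n n']
        moves_out_in[of j n n'] moves_out_in[of j n' n, symmetric])
  also have "\<dots> = W j n' * rate (j, n') (j, n)"
    by (simp add: rate_eq ring_distribs)
  finally show ?thesis by (simp add: True)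
next
  case False
  \<comment> \<open>The customer's rate cancels the tilt of the weight; what remains does not depend
    on the location, and symmetry of \<open>T\<close> finishes the case.\<close>
  have "W i n * exp (- \<phi> * real (n i)) = \<rho> ^ (\<Sum>i\<in>UNIV. n i)" for i
    by (simp add: weight_def mult.assoc exp_add[symmetric])
  then have "W i n * (exp (- \<phi> * real (n i)) * c) = \<rho> ^ (\<Sum>i\<in>UNIV. n i) * c" for i c
    by (simp only: mult.assoc[symmetric])
  then have "W j n * (exp (- \<phi> * real (n j)) * T $ j $ j') = W j' n * (exp (- \<phi> * real (n j')) * T $ j' $ j)"
    by (simp only: symmetric(3)[of j j'])
  then show ?thesis
    unfolding rate_eq if_not_P[OF False] if_not_P[OF False[symmetric]]
    by (cases "n' = n") simp_all
qed

section \<open>Exit rates and their mean\<close>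

definition targets :: "'a state \<Rightarrow> 'a state set" where
  "targets x = (\<lambda>k. (fst x, add_task k (snd x))) ` UNIV \<union> (\<lambda>k. (fst x, remove_task k (snd x))) ` UNIV \<union>
     (\<lambda>(k, l). (fst x, add_task l (remove_task k (snd x)))) ` UNIV \<union> (\<lambda>j. (j, snd x)) ` UNIV"

lemma finite_targets: "finite (targets x)"
  by (simp add: targets_def)

text \<open>The bound is uniform in the state. The set is a generous one: guards are ignored and
  \<open>x\<close> itself belongs to it.\<close>

lemma card_targets: "card (targets x) \<le> 3 * CARD('a) + CARD('a) * CARD('a)"
proof -
  let ?f = "\<lambda>k. (fst x, add_task k (snd x))" and ?g = "\<lambda>k. (fst x, remove_task k (snd x))"
    and ?h = "\<lambda>(k, l). (fst x, add_task l (remove_task k (snd x)))" and ?i = "\<lambda>j :: 'a. (j, snd x)"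
  have "card (range ?f \<union> range ?g \<union> range ?h \<union> range ?i) \<le> card (range ?f) + card (range ?g) + card (range ?h) + card (range ?i)"
    using card_Un_le[of "range ?f \<union> range ?g \<union> range ?h" "range ?i"]
      card_Un_le[of "range ?f \<union> range ?g" "range ?h"] card_Un_le[of "range ?f" "range ?g"] by linarith
  moreover have "card (range ?f) \<le> CARD('a)" "card (range ?g) \<le> CARD('a)" "card (range ?h) \<le> CARD('a \<times> 'a)"
    "card (range ?i) \<le> CARD('a)"
    by (rule card_image_le, simp)+
  ultimately show ?thesis unfolding targets_def by simp
qed

lemma rate_eq_0: "y \<notin> targets x \<Longrightarrow> rate x y = 0"
proof -
  obtain j n j' n' where xy: "x = (j, n)" "y = (j', n')" by (cases x; cases y)
  assume "y \<notin> targets x"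
  then have "j' = j \<Longrightarrow> n' \<noteq> add_task k n" "j' = j \<Longrightarrow> n' \<noteq> remove_task k n"
    "j' = j \<Longrightarrow> n' \<noteq> add_task l (remove_task k n)" "n' \<noteq> n" for k l
    by (auto simp: targets_def xy)
  then show ?thesis
    by (auto simp: xy rate_eq arrivals_def departures_def moves_def moves_out_def moves_in_def intro!: sum.neutral)
qed

text \<open>Finite support makes the infinite sum in \<open>generator\<close> a genuine sum rather
  than the default value 0 of a family that is not summable.\<close>

lemma exit_rate_eq: "- R x x = (\<Sum>y\<in>targets x - {x}. rate x y)"
proof -
  have "infsum (rate x) (- {x}) = infsum (rate x) (targets x - {x})"
    by (rule infsum_cong_neutral) (auto simp: rate_eq_0)
  then show ?thesis by (simp add: generator_def finite_targets)
qed

lemma R_off_diagonal: "x \<noteq> y \<Longrightarrow> R x y = rate x y"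
  by (simp add: generator_def)

lemma conservative_R: "(\<integral>\<^sup>+ y. (if y = x then 0 else ennreal (R x y)) \<partial>count_space UNIV) = ennreal (- R x x)"
proof -
  have "(\<integral>\<^sup>+ y. (if y = x then 0 else ennreal (R x y)) \<partial>count_space UNIV) =
     (\<Sum>y\<in>targets x - {x}. if y = x then 0 else ennreal (R x y))"
    by (rule nn_integral_count_space') (auto simp: finite_targets R_off_diagonal rate_eq_0)
  also have "\<dots> = (\<Sum>y\<in>targets x - {x}. ennreal (rate x y))"
    by (intro sum.cong) (auto simp: R_off_diagonal)
  also have "\<dots> = ennreal (- R x x)"
    unfolding exit_rate_eq by (rule sum_ennreal) (simp add: rate_nonneg)
  finally show ?thesis .
qed

lemma rate_add_task_pos: "0 < rate (j, n) (j, add_task k n)"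
proof -
  have "0 < arrivals j n (add_task k n)"
    unfolding arrivals_def using lam_pos by (intro sum_pos2[of _ k]) auto
  then show ?thesis
    using parts_nonneg[of j n "add_task k n"] by (auto simp: rate_eq intro!: add_pos_nonneg)
qed

lemma add_task_neq: "add_task k n \<noteq> n"
  by (auto simp: add_task_def fun_eq_iff)

lemma exit_rate_R: "R x x < 0"
proof -
  obtain j n where x: "x = (j, n)" by (cases x)
  have "0 < (\<Sum>y\<in>targets x - {x}. rate x y)"
    by (rule sum_pos2[of _ "(j, add_task j n)"])
       (auto simp: finite_targets rate_nonneg x rate_add_task_pos add_task_neq targets_def)
  then show ?thesis using exit_rate_eq[of x] by simp
qed

text \<open>Only the moves of the customer have rates that depend on the queue lengths, through the
  exponential kept on the right side; all other rates are bounded crudely by total sums of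
  entries.\<close>

lemma rate_bounded: "\<exists>C D. 0 \<le> C \<and> 0 \<le> D \<and> (\<forall>j n y. rate (j, n) y \<le> C + D * exp (- \<phi> * real (n j)))"
proof -
  \<comment> \<open>\<open>1 + exp \<phi>\<close> dominates the arrival factor at loaded and
    unloaded sites alike, whatever the sign of \<phi>.\<close>
  define C where "C = (\<Sum>k\<in>(UNIV :: 'a set). lam * (1 + exp \<phi>)) + (\<Sum>k\<in>(UNIV :: 'a set). mu) +
    (\<Sum>k\<in>UNIV. \<Sum>l\<in>UNIV. B $ k $ l) + (\<Sum>k\<in>UNIV. \<Sum>l\<in>UNIV. \<Theta> $ k $ l) +
    (\<Sum>l\<in>UNIV. \<Sum>k\<in>UNIV. \<Theta> $ k $ l * exp \<phi>)"
  define D where "D = (\<Sum>k\<in>UNIV. \<Sum>l\<in>UNIV. T $ k $ l)"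
  have C: "0 \<le> C" and D: "0 \<le> D"
    using lam_pos mu_pos by (auto simp: C_def D_def entries_nonneg intro!: sum_nonneg add_nonneg_nonneg mult_nonneg_nonneg)
  have row: "f i \<le> (\<Sum>k\<in>UNIV. f k)" if "\<And>k. 0 \<le> f k" for f :: "'a \<Rightarrow> real" and i
    using that by (intro member_le_sum) auto
  have "rate (j, n) (j', n') \<le> C + D * exp (- \<phi> * real (n j))" for j n j' n'
  proof (cases "j' = j")
    case True
    have "arrivals j n n' \<le> (\<Sum>k\<in>(UNIV :: 'a set). lam * (1 + exp \<phi>))"
      unfolding arrivals_def using lam_pos by (intro sum_mono) auto
    moreover have "departures j n n' \<le> (\<Sum>k\<in>(UNIV :: 'a set). mu)"
      unfolding departures_def using mu_pos by (intro sum_mono) auto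
    moreover have "moves j n n' \<le> (\<Sum>k\<in>UNIV. \<Sum>l\<in>UNIV. B $ k $ l)"
      unfolding moves_def by (intro sum_mono) (auto simp: entries_nonneg)
    moreover have "moves_out j n n' \<le> (\<Sum>k\<in>UNIV. \<Sum>l\<in>UNIV. \<Theta> $ k $ l)"
    proof -
      have "moves_out j n n' \<le> (\<Sum>l\<in>UNIV. \<Theta> $ j $ l)"
        unfolding moves_out_def by (intro sum_mono) (auto simp: entries_nonneg)
      also have "\<dots> \<le> (\<Sum>k\<in>UNIV. \<Sum>l\<in>UNIV. \<Theta> $ k $ l)"
        by (rule row) (auto simp: entries_nonneg intro!: sum_nonneg)
      finally show ?thesis .
    qed
    moreover have "moves_in j n n' \<le> (\<Sum>l\<in>UNIV. \<Sum>k\<in>UNIV. \<Theta> $ k $ l * exp \<phi>)"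
    proof -
      have "moves_in j n n' \<le> (\<Sum>k\<in>UNIV. \<Theta> $ k $ j * exp \<phi>)"
        unfolding moves_in_def by (intro sum_mono) (auto simp: entries_nonneg)
      also have "\<dots> \<le> (\<Sum>l\<in>UNIV. \<Sum>k\<in>UNIV. \<Theta> $ k $ l * exp \<phi>)"
        by (rule row) (auto simp: entries_nonneg intro!: sum_nonneg)
      finally show ?thesis .
    qed
    ultimately have "rate (j, n) (j', n') \<le> C"
      unfolding rate_eq C_def using True by simp
    also have "C \<le> C + D * exp (- \<phi> * real (n j))" using D by simp
    finally show ?thesis .
  next
    case False
    have "T $ j $ j' \<le> (\<Sum>l\<in>UNIV. T $ j $ l)" by (rule row) (simp add: entries_nonneg)
    also have "\<dots> \<le> D" unfolding D_def by (rule row) (auto simp: entries_nonneg intro!: sum_nonneg)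
    finally have "exp (- \<phi> * real (n j)) * T $ j $ j' \<le> D * exp (- \<phi> * real (n j))" by simp
    then show ?thesis using False C D by (auto simp: rate_eq intro: add_increasing)
  qed
  then show ?thesis using C D by (intro exI[of _ C] exI[of _ D]) auto
qed

lemma \<rho>_pos: "0 < \<rho>" using lam_pos mu_pos by simp

lemmas pmf_stationary = pmf_network_pmf[OF \<rho>_pos lam_mu lam_exp_mu]

lemma weight_pos: "0 < W j n"
  using \<rho>_pos by (simp add: weight_def)

lemma norm_const_pos: "0 < 1 / real CARD('a) * (1 - \<rho> * exp \<phi>) * (1 - \<rho>) ^ (CARD('a) - 1)"
  using lam_mu lam_exp_mu by simp

text \<open>
  Multiplying \<open>network_pmf \<rho> \<phi>\<close> by \<open>exp (- \<phi> * n j)\<close> gives a multiple of \<open>network_pmf \<rho> 0\<close>, so the unbounded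
  part of the exit rates is integrable.
\<close>

lemma finite_mean_rate_R: "(\<integral>\<^sup>+ x. ennreal (- R x x) \<partial>measure_pmf (network_pmf \<rho> \<phi>)) < \<infinity>"
proof -
  obtain C D where C: "0 \<le> C" and D: "0 \<le> D" and CD: "\<And>j n y. rate (j, n) y \<le> C + D * exp (- \<phi> * real (n j))"
    using rate_bounded by blast
  define N where "N = real (3 * CARD('a) + CARD('a) * CARD('a))"
  \<comment> \<open>The ratio of the normalising constants of
    \<open>network_pmf \<rho> \<phi>\<close> and \<open>network_pmf \<rho> 0\<close>; all other
    factors agree.\<close>
  define c where "c = (1 - \<rho> * exp \<phi>) / (1 - \<rho>)"
  have c: "0 \<le> c" using lam_mu lam_exp_mu by (simp add: c_def)
  have bound: "pmf (network_pmf \<rho> \<phi>) x * (- R x x) \<le> N * C * pmf (network_pmf \<rho> \<phi>) x + N * D * c * pmf (network_pmf \<rho> 0) x" for x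
  proof -
    obtain j n where x: "x = (j, n)" by (cases x)
    have "- R x x \<le> real (card (targets x - {x})) * (C + D * exp (- \<phi> * real (n j)))"
      unfolding exit_rate_eq using CD by (intro sum_bounded_above) (simp add: x)
    also have "\<dots> \<le> N * (C + D * exp (- \<phi> * real (n j)))"
    proof (intro mult_right_mono)
      have "card (targets x - {x}) \<le> card (targets x)" by (intro card_mono finite_targets) auto
      then show "real (card (targets x - {x})) \<le> N" using card_targets[of x] unfolding N_def by linarith
    qed (use C D in simp)
    finally have "pmf (network_pmf \<rho> \<phi>) x * (- R x x) \<le> pmf (network_pmf \<rho> \<phi>) x * (N * (C + D * exp (- \<phi> * real (n j))))"
      by (intro mult_left_mono) simp_all
    also have "\<dots> = N * C * pmf (network_pmf \<rho> \<phi>) x + N * D * (pmf (network_pmf \<rho> \<phi>) x * exp (- \<phi> * real (n j)))"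
      by (simp add: ring_distribs mult_ac)
    also have "pmf (network_pmf \<rho> \<phi>) x * exp (- \<phi> * real (n j)) = c * pmf (network_pmf \<rho> 0) x"
    proof -
      have "weight \<rho> \<phi> j n * exp (- \<phi> * real (n j)) = weight \<rho> 0 j n"
        by (simp add: weight_def exp_minus)
      then show ?thesis
        using lam_mu \<rho>_pos unfolding x pmf_stationary
        by (subst pmf_network_pmf) (auto simp: c_def mult.assoc)
    qed
    finally show ?thesis by simp
  qed
  have N: "0 \<le> N" by (simp add: N_def)
  have "(\<integral>\<^sup>+ x. ennreal (- R x x) \<partial>measure_pmf (network_pmf \<rho> \<phi>)) \<le>
     (\<integral>\<^sup>+ x. ennreal (N * C) * ennreal (pmf (network_pmf \<rho> \<phi>) x) + ennreal (N * D * c) * ennreal (pmf (network_pmf \<rho> 0) x)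
       \<partial>count_space (UNIV :: 'a state set))"
    unfolding nn_integral_measure_pmf
  proof (intro nn_integral_mono)
    fix x
    have "ennreal (pmf (network_pmf \<rho> \<phi>) x) * ennreal (- R x x) = ennreal (pmf (network_pmf \<rho> \<phi>) x * (- R x x))"
      using exit_rate_R[of x] by (intro ennreal_mult[symmetric]) auto
    also have "\<dots> \<le> ennreal (N * C * pmf (network_pmf \<rho> \<phi>) x + N * D * c * pmf (network_pmf \<rho> 0) x)"
      by (intro ennreal_leI bound)
    also have "\<dots> = ennreal (N * C) * ennreal (pmf (network_pmf \<rho> \<phi>) x) + ennreal (N * D * c) * ennreal (pmf (network_pmf \<rho> 0) x)"
      using N C D c by (simp add: ennreal_mult[symmetric] ennreal_plus[symmetric] del: ennreal_plus)
    finally show "ennreal (pmf (network_pmf \<rho> \<phi>) x) * ennreal (- R x x) \<le> \<dots>" .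
  qed
  also have "\<dots> = ennreal (N * C) + ennreal (N * D * c)"
    by (simp add: nn_integral_add nn_integral_cmult nn_integral_pmf_eq_1)
  also have "\<dots> < \<infinity>" by (simp add: less_top[symmetric])
  finally show ?thesis .
qed

section \<open>Irreducibility of the network\<close>

definition edges :: "('a state \<times> 'a state) set" where
  "edges = {(x, y). x \<noteq> y \<and> 0 < R x y}"

lemma edges_iff: "(x, y) \<in> edges \<longleftrightarrow> x \<noteq> y \<and> 0 < rate x y"
  by (auto simp: edges_def R_off_diagonal)

text \<open>Detailed balance with positive weights makes every transition reversible, so emptying
  the network needs no path of its own: it is filling it, read backwards.\<close>

lemma sym_edges: "sym edges"
proof (rule symI)
  fix x y assume xy: "(x, y) \<in> edges"
  obtain j n where x: "x = (j, n)" by (cases x)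
  obtain j' n' where y: "y = (j', n')" by (cases y)
  have "0 < W j n * rate x y" using xy weight_pos[of j n] by (simp add: edges_iff)
  also have "W j n * rate x y = W j' n' * rate y x" unfolding x y by (rule weight_balance)
  finally have "0 < rate y x" by (rule zero_less_mult_pos) (rule weight_pos)
  then show "(y, x) \<in> edges" using xy by (auto simp: edges_iff)
qed

lemma from_empty: "((j, \<lambda>_. 0), (j, n)) \<in> edges\<^sup>*"
proof (induction "\<Sum>i\<in>UNIV. n i" arbitrary: n)
  case 0
  then have "(\<Sum>i\<in>UNIV. n i) = 0" by (rule sym)
  then have "n = (\<lambda>_. 0)" by (simp add: fun_eq_iff)
  then show ?case by simp
next
  case (Suc m)
  have "(\<Sum>i\<in>UNIV. n i) \<noteq> 0" using Suc.hyps(2) by linarith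
  then obtain k where "n k \<noteq> 0" by (rule sum.not_neutral_contains_not_neutral)
  then have "n = add_task k (remove_task k n)" by (intro add_remove_task[symmetric]) simp
  then obtain n0 where n: "n = add_task k n0" by blast
  then have "m = (\<Sum>i\<in>UNIV. n0 i)"
    using Suc.hyps(2) unfolding n sum_add_task by simp
  then have "((j, \<lambda>_. 0), (j, n0)) \<in> edges\<^sup>*" by (rule Suc.hyps(1))
  moreover have "((j, n0), (j, n)) \<in> edges"
    unfolding edges_iff n using rate_add_task_pos[of j n0 k] add_task_neq[of k n0, symmetric] by simp
  ultimately show ?case by (rule rtrancl_into_rtrancl)
qed

lemma customer_moves: "((j, n), (j', n)) \<in> edges\<^sup>*"
proof -
  obtain u where "positive_matrix (mat_power T u)" using T_irreducible by blast
  then have "mat_power T u $ j $ j' \<noteq> 0" by (metis positive_matrix_def less_irrefl)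
  then have "(j, j') \<in> {(i, k). 0 < T $ i $ k}\<^sup>*" by (rule mat_power_path[OF admissible_T])
  then show ?thesis
  proof (induction rule: rtrancl_induct)
    case (step i k)
    \<comment> \<open>The zero diagonal ensures that a positive entry moves the customer to a
      different site, so the step is an edge.\<close>
    have "T $ i $ i = 0" using admissible_T by (simp add: admissible_matrix_def)
    then have "((i, n), (k, n)) \<in> edges" using step by (auto simp: edges_iff rate_eq)
    with step.IH show ?case by (rule rtrancl_into_rtrancl)
  qed simp
qed

text \<open>The route passes through the empty network, where the customer is relocated before the
  tasks are added.\<close>

lemma irreducible_R: "(x, y) \<in> edges\<^sup>*"
proof -
  obtain j n j' n' where xy: "x = (j, n)" "y = (j', n')" by (cases x; cases y)
  have "((j, n), (j, \<lambda>_. 0)) \<in> edges\<^sup>*"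
    using from_empty sym_rtrancl[OF sym_edges] by (auto dest: symD)
  also have "((j, \<lambda>_. 0), (j', \<lambda>_. 0)) \<in> edges\<^sup>*" by (rule customer_moves)
  also have "((j', \<lambda>_. 0), (j', n')) \<in> edges\<^sup>*" by (rule from_empty)
  finally show ?thesis by (simp add: xy)
qed

sublocale reversible_ctmc R "network_pmf \<rho> \<phi>"
proof
  fix x y :: "'a state"
  obtain j n j' n' where xy: "x = (j, n)" "y = (j', n')" by (cases x; cases y)
  show "0 \<le> R x y" if "x \<noteq> y" using that by (simp add: R_off_diagonal rate_nonneg)
  show "R x x < 0" by (rule exit_rate_R)
  show "(\<integral>\<^sup>+ y. (if y = x then 0 else ennreal (R x y)) \<partial>count_space UNIV) = ennreal (- R x x)"
    by (rule conservative_R)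
  show "0 < pmf (network_pmf \<rho> \<phi>) x"
    unfolding xy pmf_stationary using norm_const_pos weight_pos by (rule mult_pos_pos)
  show "pmf (network_pmf \<rho> \<phi>) x * R x y = pmf (network_pmf \<rho> \<phi>) y * R y x"
  proof (cases "x = y")
    case False
    then show ?thesis
      using weight_balance[of j n j' n'] unfolding R_off_diagonal[OF False] R_off_diagonal[OF False[symmetric]]
      by (simp only: xy pmf_stationary mult.assoc)
  qed simp
  show "(\<integral>\<^sup>+ x. ennreal (- R x x) \<partial>measure_pmf (network_pmf \<rho> \<phi>)) < \<infinity>" by (rule finite_mean_rate_R)
  show "(x, y) \<in> {(x, y). x \<noteq> y \<and> 0 < R x y}\<^sup>*" using irreducible_R by (simp add: edges_def)
qed

end

theorem theorem3p1:
  fixes lam mu \<phi> :: real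
    and B \<Theta> T :: "real^'a^'a::finite"
  assumes "0 < lam" and "0 < mu"
    and "admissible_matrix B" and "admissible_matrix \<Theta>" and "admissible_matrix T"
    and "\<exists>u>0. positive_matrix (mat_power B u) \<and> positive_matrix (mat_power \<Theta> u) \<and>
               positive_matrix (mat_power T u)"
    and "lam / mu < 1" and "lam * exp \<phi> / mu < 1"
  defines "R \<equiv> generator lam mu \<phi> B \<Theta> T"
  shows "positive_recurrent R \<and>
    (\<exists>\<pi>. stationary R \<pi> \<and> (\<forall>\<nu>. stationary R \<nu> \<longrightarrow> \<nu> = \<pi>) \<and> reversible R \<pi> \<and>
      (\<forall>j n. pmf \<pi> (j, n) =
         1 / real CARD('a) * (1 - lam * exp \<phi> / mu) * (1 - lam / mu) ^ (CARD('a) - 1) *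
         (lam / mu) ^ (\<Sum>i\<in>UNIV. n i) * exp (\<phi> * real (n j))))"
proof -
  interpret network lam mu \<phi> B \<Theta> T
    using assms by unfold_locales auto
  show ?thesis
    unfolding R_def
    by (intro conjI exI[of _ "network_pmf (lam / mu) \<phi>"] allI impI positive_recurrent stationary_\<pi> reversible_\<pi>)
       (auto simp: stationary_unique pmf_stationary weight_def)
qed

end
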